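(* Let $R$ be a ring, let $G$ be a finitely generated group, and let $\varphi\in S(G)$. Let $C_{n+1}\xrightarrow{\partial_{n+1}}C_n\xrightarrow{\partial_n}C_{n-1}$ be a chain complex of based free $\widehat{RG}^{\varphi}$-modules with $C_n$ and $C_{n-1}$ finitely generated and with $\partial_{n+1},\partial_n$ defined over $\mathcal{D}:=\mathcal{D}(RG\subset\widehat{RG}^{\varphi})$. Suppose that we are given $\widehat{RG}^{\varphi}$-module homomorphisms $H_{n-1}\colon C_{n-1}\to C_n$ defined over $\mathcal{D}$ and $H_n\colon C_n\to C_{n+1}$ (defined over $\widehat{RG}^{\varphi}$) satisfying $H_{n-1}\partial_n+\partial_{n+1}H_n=\mathrm{id}_{C_n}$. Then $H_n$ may be taken to be defined over $\mathcal{D}$; that is, there exists a homomorphism $H_n'\colon C_n\to C_{n+1}$ defined over $\mathcal{D}$ with $H_{n-1}\partial_n+\partial_{n+1}H_n'=\mathrm{id}_{C_n}$.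
   Context: Rings are associative and unital; modules are right modules. $S(G)=\mathrm{Hom}(G;\mathbb{R})\smallsetminus\{0\}$. The Novikov–Sikorav ring $\widehat{RG}^{\varphi}$ is the ring of formal sums $\sum_{g\in G}n_gg$, $n_g\in R$, such that $\{g:n_g\ne0\text{ and }\varphi(g)<s\}$ is finite for every $s\in\mathbb{R}$; it contains $RG$. The division closure $\mathcal{D}(S\subset A)$ of a subring $S$ in a ring $A$ is the smallest subring of $A$ containing $S$ in which every element invertible in $A$ is invertible. A homomorphism between based free $\widehat{RG}^{\varphi}$-modules is defined over a subring if all entries of its matrix with respect to the given bases lie in that subring. *)

theory Defs
  imports Complex_Main "HOL-Algebra.Algebra"
begin

section \<open>Finitely generated groups and characters\<close>

definition finitely_generated_group :: "('g, 'q) monoid_scheme \<Rightarrow> bool" where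
  "finitely_generated_group G \<longleftrightarrow>
     group G \<and> (\<exists>S. finite S \<and> S \<subseteq> carrier G \<and> generate G S = carrier G)"

definition real_add_group :: "real monoid" where
  "real_add_group = \<lparr>carrier = UNIV, monoid.mult = (+), one = 0\<rparr>"

text \<open>The set \<open>S(G) = Hom(G; \<real>) - {0}\<close>. Values of a character outside \<open>carrier G\<close> are irrelevant.\<close>

definition characters :: "('g, 'q) monoid_scheme \<Rightarrow> ('g \<Rightarrow> real) set" where
  "characters G = {\<phi> \<in> hom G real_add_group. \<exists>g\<in>carrier G. \<phi> g \<noteq> 0}"

section \<open>The Novikov--Sikorav ring and the group ring\<close>

text \<open>A formal sum \<open>\<Sum> n\<^sub>g g\<close> is its coefficient function \<open>g \<mapsto> n\<^sub>g\<close>, an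
  extensional function from \<open>carrier G\<close> to \<open>carrier R\<close>.\<close>

definition supp :: "('r, 'p) ring_scheme \<Rightarrow> 'i set \<Rightarrow> ('i \<Rightarrow> 'r) \<Rightarrow> 'i set" where
  "supp R I x = {i \<in> I. x i \<noteq> \<zero>\<^bsub>R\<^esub>}"

definition novikov_carrier ::
  "('r, 'p) ring_scheme \<Rightarrow> ('g, 'q) monoid_scheme \<Rightarrow> ('g \<Rightarrow> real) \<Rightarrow> ('g \<Rightarrow> 'r) set" where
  "novikov_carrier R G \<phi> =
     {x \<in> carrier G \<rightarrow>\<^sub>E carrier R. \<forall>s::real. finite {g \<in> supp R (carrier G) x. \<phi> g < s}}"

text \<open>The coefficient of \<open>g\<close> in a product is the sum of \<open>x(h) y(k)\<close> over all \<open>h, k\<close> with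
  \<open>h k = g\<close>. For elements of the Novikov--Sikorav ring only finitely many such pairs
  have both coefficients nonzero, and the sum is restricted to those.\<close>

definition conv ::
  "('r, 'p) ring_scheme \<Rightarrow> ('g, 'q) monoid_scheme \<Rightarrow> ('g \<Rightarrow> 'r) \<Rightarrow> ('g \<Rightarrow> 'r) \<Rightarrow> ('g \<Rightarrow> 'r)" where
  "conv R G x y = (\<lambda>g\<in>carrier G.
     \<Oplus>\<^bsub>R\<^esub>h \<in> {h \<in> supp R (carrier G) x. inv\<^bsub>G\<^esub> h \<otimes>\<^bsub>G\<^esub> g \<in> supp R (carrier G) y}.
       x h \<otimes>\<^bsub>R\<^esub> y (inv\<^bsub>G\<^esub> h \<otimes>\<^bsub>G\<^esub> g))"

definition novikov_ring ::
  "('r, 'p) ring_scheme \<Rightarrow> ('g, 'q) monoid_scheme \<Rightarrow> ('g \<Rightarrow> real) \<Rightarrow> ('g \<Rightarrow> 'r) ring" where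
  "novikov_ring R G \<phi> =
     \<lparr>carrier = novikov_carrier R G \<phi>,
      monoid.mult = conv R G,
      one = (\<lambda>g\<in>carrier G. if g = \<one>\<^bsub>G\<^esub> then \<one>\<^bsub>R\<^esub> else \<zero>\<^bsub>R\<^esub>),
      ring.zero = (\<lambda>g\<in>carrier G. \<zero>\<^bsub>R\<^esub>),
      ring.add = (\<lambda>x y. \<lambda>g\<in>carrier G. x g \<oplus>\<^bsub>R\<^esub> y g)\<rparr>"

text \<open>The group ring as a subset of \<open>novikov_ring R G \<phi>\<close>, for any \<open>\<phi>\<close>.\<close>

definition group_ring :: "('r, 'p) ring_scheme \<Rightarrow> ('g, 'q) monoid_scheme \<Rightarrow> ('g \<Rightarrow> 'r) set" where
  "group_ring R G = {x \<in> carrier G \<rightarrow>\<^sub>E carrier R. finite (supp R (carrier G) x)}"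

section \<open>Division closure\<close>

definition division_closed :: "('a, 'x) ring_scheme \<Rightarrow> 'a set \<Rightarrow> bool" where
  "division_closed A T \<longleftrightarrow>
     subring T A \<and> T \<inter> Units A \<subseteq> Units (A\<lparr>carrier := T\<rparr>)"

definition division_closure :: "('a, 'x) ring_scheme \<Rightarrow> 'a set \<Rightarrow> 'a set" where
  "division_closure A S = \<Inter>{T. division_closed A T \<and> S \<subseteq> T}"

section \<open>Right modules, bases and matrices\<close>

text \<open>As in \<^theory>\<open>HOL-Algebra.Module\<close>, the multiplicative fields
  inherited from the ring record are unused. The library's \<open>module\<close> requires a commutative ring
  of scalars.\<close>

record ('a, 'm) right_module = "'m ring" +
  rsmult :: "'m \<Rightarrow> 'a \<Rightarrow> 'm" (infixl \<open>\<cdot>\<index>\<close> 70)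

locale right_module = A?: ring A + M?: abelian_group M
  for A :: "('a, 'x) ring_scheme" (structure)
    and M :: "('a, 'm, 'y) right_module_scheme" (structure) +
  assumes rsmult_closed [simp, intro]:
      "\<lbrakk>m \<in> carrier M; a \<in> carrier A\<rbrakk> \<Longrightarrow> m \<cdot>\<^bsub>M\<^esub> a \<in> carrier M"
    and rsmult_l_distr:
      "\<lbrakk>m \<in> carrier M; m' \<in> carrier M; a \<in> carrier A\<rbrakk>
         \<Longrightarrow> (m \<oplus>\<^bsub>M\<^esub> m') \<cdot>\<^bsub>M\<^esub> a = m \<cdot>\<^bsub>M\<^esub> a \<oplus>\<^bsub>M\<^esub> m' \<cdot>\<^bsub>M\<^esub> a"
    and rsmult_r_distr:
      "\<lbrakk>m \<in> carrier M; a \<in> carrier A; b \<in> carrier A\<rbrakk>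
         \<Longrightarrow> m \<cdot>\<^bsub>M\<^esub> (a \<oplus>\<^bsub>A\<^esub> b) = m \<cdot>\<^bsub>M\<^esub> a \<oplus>\<^bsub>M\<^esub> m \<cdot>\<^bsub>M\<^esub> b"
    and rsmult_assoc:
      "\<lbrakk>m \<in> carrier M; a \<in> carrier A; b \<in> carrier A\<rbrakk>
         \<Longrightarrow> m \<cdot>\<^bsub>M\<^esub> (a \<otimes>\<^bsub>A\<^esub> b) = (m \<cdot>\<^bsub>M\<^esub> a) \<cdot>\<^bsub>M\<^esub> b"
    and rsmult_one [simp]:
      "m \<in> carrier M \<Longrightarrow> m \<cdot>\<^bsub>M\<^esub> \<one>\<^bsub>A\<^esub> = m"

definition finitely_generated_module ::
  "('a, 'x) ring_scheme \<Rightarrow> ('a, 'm, 'y) right_module_scheme \<Rightarrow> bool" where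
  "finitely_generated_module A M \<longleftrightarrow>
     (\<exists>S. finite S \<and> S \<subseteq> carrier M \<and>
        (\<forall>m\<in>carrier M. \<exists>c\<in>S \<rightarrow> carrier A. m = (\<Oplus>\<^bsub>M\<^esub>s\<in>S. s \<cdot>\<^bsub>M\<^esub> c s)))"

definition right_module_hom ::
  "('a, 'x) ring_scheme \<Rightarrow> ('a, 'm, 'y) right_module_scheme \<Rightarrow>
     ('a, 'n, 'z) right_module_scheme \<Rightarrow> ('m \<Rightarrow> 'n) set" where
  "right_module_hom A M N =
     {f \<in> carrier M \<rightarrow> carrier N.
        (\<forall>m\<in>carrier M. \<forall>m'\<in>carrier M. f (m \<oplus>\<^bsub>M\<^esub> m') = f m \<oplus>\<^bsub>N\<^esub> f m') \<and>
        (\<forall>m\<in>carrier M. \<forall>a\<in>carrier A. f (m \<cdot>\<^bsub>M\<^esub> a) = f m \<cdot>\<^bsub>N\<^esub> a)}"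

definition is_coordinates ::
  "('a, 'x) ring_scheme \<Rightarrow> ('a, 'm, 'y) right_module_scheme \<Rightarrow> 'i set \<Rightarrow> ('i \<Rightarrow> 'm) \<Rightarrow>
     'm \<Rightarrow> ('i \<Rightarrow> 'a) \<Rightarrow> bool" where
  "is_coordinates A M I b m c \<longleftrightarrow>
     c \<in> I \<rightarrow>\<^sub>E carrier A \<and> finite (supp A I c) \<and>
     m = (\<Oplus>\<^bsub>M\<^esub>i\<in>supp A I c. b i \<cdot>\<^bsub>M\<^esub> c i)"

text \<open>A based free module is a right module with a basis, given as a family \<open>b\<close> indexed by an
  arbitrary (possibly infinite) set \<open>I\<close>.\<close>

definition based_free ::
  "('a, 'x) ring_scheme \<Rightarrow> ('a, 'm, 'y) right_module_scheme \<Rightarrow> 'i set \<Rightarrow> ('i \<Rightarrow> 'm) \<Rightarrow> bool" where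
  "based_free A M I b \<longleftrightarrow>
     right_module A M \<and> b \<in> I \<rightarrow> carrier M \<and>
     (\<forall>m\<in>carrier M. \<exists>!c. is_coordinates A M I b m c)"

definition coordinates ::
  "('a, 'x) ring_scheme \<Rightarrow> ('a, 'm, 'y) right_module_scheme \<Rightarrow> 'i set \<Rightarrow> ('i \<Rightarrow> 'm) \<Rightarrow>
     'm \<Rightarrow> ('i \<Rightarrow> 'a)" where
  "coordinates A M I b m = (THE c. is_coordinates A M I b m c)"

definition matrix_entry ::
  "('a, 'x) ring_scheme \<Rightarrow> ('i \<Rightarrow> 'm) \<Rightarrow>
     ('a, 'n, 'z) right_module_scheme \<Rightarrow> 'j set \<Rightarrow> ('j \<Rightarrow> 'n) \<Rightarrow> ('m \<Rightarrow> 'n) \<Rightarrow> 'j \<Rightarrow> 'i \<Rightarrow> 'a" where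
  "matrix_entry A b N J b' f j i = coordinates A N J b' (f (b i)) j"

definition defined_over ::
  "('a, 'x) ring_scheme \<Rightarrow> 'a set \<Rightarrow> 'i set \<Rightarrow> ('i \<Rightarrow> 'm) \<Rightarrow>
     ('a, 'n, 'z) right_module_scheme \<Rightarrow> 'j set \<Rightarrow> ('j \<Rightarrow> 'n) \<Rightarrow> ('m \<Rightarrow> 'n) \<Rightarrow> bool" where
  "defined_over A D I b N J b' f \<longleftrightarrow>
     (\<forall>j\<in>J. \<forall>i\<in>I. matrix_entry A b N J b' f j i \<in> D)"

section \<open>The Novikov--Sikorav ring is a ring, and division closures are division closed\<close>

lemma (in abelian_monoid) finsum_swap:
  assumes "finite XX" "finite YY" "\<And>a b. a \<in> XX \<Longrightarrow> b \<in> YY \<Longrightarrow> f a b \<in> carrier G"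
  shows "(\<Oplus>a\<in>XX. \<Oplus>b\<in>YY. f a b) = (\<Oplus>b\<in>YY. \<Oplus>a\<in>XX. f a b)"
  using assms(1,3)
proof (induction XX rule: finite_induct)
  case empty
  then show ?case by (simp add: add.finprod_one)
next
  case (insert x XX)
  have 1: "(\<lambda>b. f x b) \<in> YY \<rightarrow> carrier G" "(\<lambda>a. \<Oplus>b\<in>YY. f a b) \<in> XX \<rightarrow> carrier G"
    "(\<lambda>b. \<Oplus>a\<in>XX. f a b) \<in> YY \<rightarrow> carrier G"
    using insert.prems by (auto intro!: finsum_closed)
  have "(\<Oplus>b\<in>YY. \<Oplus>a\<in>insert x XX. f a b) = (\<Oplus>b\<in>YY. f x b \<oplus> (\<Oplus>a\<in>XX. f a b))"
    using insert by (intro finsum_cong') (auto intro!: finsum_insert a_closed finsum_closed)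
  then show ?case
    using insert 1 by (simp add: finsum_addf Pi_iff finsum_closed)
qed

locale novikov = R: ring R + G: group G
  for R :: "('r, 'p) ring_scheme" and G :: "('g, 'q) monoid_scheme" +
  fixes \<phi> :: "'g \<Rightarrow> real"
  assumes hom: "\<phi> \<in> hom G real_add_group"
begin

lemma phi_mult: "g \<in> carrier G \<Longrightarrow> h \<in> carrier G \<Longrightarrow> \<phi> (g \<otimes>\<^bsub>G\<^esub> h) = \<phi> g + \<phi> h"
  using hom by (auto simp: hom_def real_add_group_def)

lemma phi_one: "\<phi> \<one>\<^bsub>G\<^esub> = 0"
  using phi_mult[of "\<one>\<^bsub>G\<^esub>" "\<one>\<^bsub>G\<^esub>"] by simp

lemma phi_inv: "g \<in> carrier G \<Longrightarrow> \<phi> (inv\<^bsub>G\<^esub> g) = - \<phi> g"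
  using phi_mult[of g "inv\<^bsub>G\<^esub> g"] phi_one by simp

abbreviation "N \<equiv> novikov_carrier R G \<phi>"

lemma N_closed: "x \<in> N \<Longrightarrow> g \<in> carrier G \<Longrightarrow> x g \<in> carrier R"
  by (auto simp: novikov_carrier_def)

lemma N_ext: "x \<in> N \<Longrightarrow> y \<in> N \<Longrightarrow> (\<And>g. g \<in> carrier G \<Longrightarrow> x g = y g) \<Longrightarrow> x = y"
  unfolding novikov_carrier_def by (auto intro: PiE_ext)

lemma N_below: 
  assumes "x \<in> N" obtains m where "\<And>g. g \<in> supp R (carrier G) x \<Longrightarrow> m \<le> \<phi> g"
proof -
  let ?F = "{g \<in> supp R (carrier G) x. \<phi> g < 0}"
  have fin: "finite ?F" using assms by (auto simp: novikov_carrier_def)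
  have "Min (insert 0 (\<phi> ` ?F)) \<le> \<phi> g" if "g \<in> supp R (carrier G) x" for g
  proof (cases "\<phi> g < 0")
    case True then show ?thesis using fin that by (intro Min_le) auto
  next
    case False
    have "Min (insert 0 (\<phi> ` ?F)) \<le> 0" using fin by (intro Min_le) auto
    then show ?thesis using False by simp
  qed
  then show thesis using that by blast
qed

definition low where "low x s = {g \<in> supp R (carrier G) x. \<phi> g < s}"

lemma low_finite: "x \<in> N \<Longrightarrow> finite (low x s)" by (auto simp: low_def novikov_carrier_def)
lemma low_sub: "low x s \<subseteq> carrier G" by (auto simp: low_def supp_def)

lemma conv_eq:
  assumes x: "x \<in> N" and y: "y \<in> N" and g: "g \<in> carrier G" and F: "finite F" "F \<subseteq> carrier G"
    and cov: "\<And>h. h \<in> supp R (carrier G) x \<Longrightarrow> inv\<^bsub>G\<^esub> h \<otimes>\<^bsub>G\<^esub> g \<in> supp R (carrier G) y \<Longrightarrow> h \<in> F"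
  shows "conv R G x y g = (\<Oplus>\<^bsub>R\<^esub>h\<in>F. x h \<otimes>\<^bsub>R\<^esub> y (inv\<^bsub>G\<^esub> h \<otimes>\<^bsub>G\<^esub> g))"
proof -
  have cl: "h \<in> F \<Longrightarrow> x h \<in> carrier R \<and> y (inv\<^bsub>G\<^esub> h \<otimes>\<^bsub>G\<^esub> g) \<in> carrier R" for h
    using F g N_closed[OF x] N_closed[OF y] by auto
  show ?thesis
    unfolding conv_def using g
    by (simp, intro R.add.finprod_mono_neutral_cong_left) (use F cov cl g in \<open>auto simp: supp_def\<close>)
qed

lemma suppD: "g \<in> supp R (carrier G) x \<Longrightarrow> g \<in> carrier G" by (auto simp: supp_def)

lemma supp_conv:
  assumes x: "x \<in> N" and y: "y \<in> N" and g: "g \<in> supp R (carrier G) (conv R G x y)"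
  shows "\<exists>h\<in>supp R (carrier G) x. inv\<^bsub>G\<^esub> h \<otimes>\<^bsub>G\<^esub> g \<in> supp R (carrier G) y"
proof (rule ccontr)
  assume "\<not> ?thesis"
  then have "{h \<in> supp R (carrier G) x. inv\<^bsub>G\<^esub> h \<otimes>\<^bsub>G\<^esub> g \<in> supp R (carrier G) y} = {}" by auto
  then have "conv R G x y g = \<zero>\<^bsub>R\<^esub>" using suppD[OF g] by (simp only: conv_def restrict_apply' R.finsum_empty)
  then show False using g by (auto simp: supp_def)
qed

lemma split: "g \<in> carrier G \<Longrightarrow> h \<in> carrier G \<Longrightarrow> \<phi> g = \<phi> h + \<phi> (inv\<^bsub>G\<^esub> h \<otimes>\<^bsub>G\<^esub> g)"
  by (simp add: phi_mult phi_inv)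

lemma conv_closed:
  assumes x: "x \<in> N" and y: "y \<in> N"
  shows "conv R G x y \<in> N"
proof -
  obtain mx where mx: "\<And>g. g \<in> supp R (carrier G) x \<Longrightarrow> mx \<le> \<phi> g" using N_below[OF x] by blast
  obtain my where my: "\<And>g. g \<in> supp R (carrier G) y \<Longrightarrow> my \<le> \<phi> g" using N_below[OF y] by blast
  have "conv R G x y \<in> carrier G \<rightarrow>\<^sub>E carrier R"
    unfolding conv_def using N_closed[OF x] N_closed[OF y]
    by (auto intro!: R.finsum_closed simp: supp_def)
  moreover have "finite {g \<in> supp R (carrier G) (conv R G x y). \<phi> g < s}" for s
  proof (rule finite_subset)
    show "finite ((\<lambda>(h,k). h \<otimes>\<^bsub>G\<^esub> k) ` (low x (s - my) \<times> low y (s - mx)))"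
      using low_finite[OF x] low_finite[OF y] by auto
    show "{g \<in> supp R (carrier G) (conv R G x y). \<phi> g < s} \<subseteq> (\<lambda>(h,k). h \<otimes>\<^bsub>G\<^esub> k) ` (low x (s - my) \<times> low y (s - mx))"
    proof clarsimp
      fix g assume g: "g \<in> supp R (carrier G) (conv R G x y)" "\<phi> g < s"
      from supp_conv[OF x y g(1)] obtain h where h: "h \<in> supp R (carrier G) x"
        "inv\<^bsub>G\<^esub> h \<otimes>\<^bsub>G\<^esub> g \<in> supp R (carrier G) y" by blast
      have c: "g \<in> carrier G" "h \<in> carrier G" using g h suppD by auto
      have "h \<in> low x (s - my)" "inv\<^bsub>G\<^esub> h \<otimes>\<^bsub>G\<^esub> g \<in> low y (s - mx)"
        using h g mx[OF h(1)] my[OF h(2)] split[OF c] by (auto simp: low_def)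
      moreover have "g = h \<otimes>\<^bsub>G\<^esub> (inv\<^bsub>G\<^esub> h \<otimes>\<^bsub>G\<^esub> g)" using c by (simp add: G.m_assoc[symmetric])
      ultimately show "g \<in> (\<lambda>(h,k). h \<otimes>\<^bsub>G\<^esub> k) ` (low x (s - my) \<times> low y (s - mx))"
        by (intro image_eqI[of _ _ "(h, inv\<^bsub>G\<^esub> h \<otimes>\<^bsub>G\<^esub> g)"]) auto
    qed
  qed
  ultimately show ?thesis by (auto simp: novikov_carrier_def)
qed

lemma conv_low:
  assumes x: "x \<in> N" and y: "y \<in> N" and g: "g \<in> carrier G"
    and my: "\<And>g. g \<in> supp R (carrier G) y \<Longrightarrow> my \<le> \<phi> g" and s: "\<phi> g - my < s"
  shows "conv R G x y g = (\<Oplus>\<^bsub>R\<^esub>h\<in>low x s. x h \<otimes>\<^bsub>R\<^esub> y (inv\<^bsub>G\<^esub> h \<otimes>\<^bsub>G\<^esub> g))"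
proof (rule conv_eq[OF x y g low_finite[OF x] low_sub])
  fix h assume h: "h \<in> supp R (carrier G) x" "inv\<^bsub>G\<^esub> h \<otimes>\<^bsub>G\<^esub> g \<in> supp R (carrier G) y"
  show "h \<in> low x s" using h my[OF h(2)] split[OF g suppD[OF h(1)]] s by (auto simp: low_def)
qed

lemma conv_assoc:
  assumes x: "x \<in> N" and y: "y \<in> N" and z: "z \<in> N"
  shows "conv R G (conv R G x y) z = conv R G x (conv R G y z)"
proof (rule N_ext)
  show "conv R G (conv R G x y) z \<in> N" "conv R G x (conv R G y z) \<in> N"
    using assms conv_closed by auto
next
  fix g assume g: "g \<in> carrier G"
  note xy = conv_closed[OF x y] and yz = conv_closed[OF y z]
  obtain my where my: "\<And>g. g \<in> supp R (carrier G) y \<Longrightarrow> my \<le> \<phi> g" using N_below[OF y] by blast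
  obtain mz where mz: "\<And>g. g \<in> supp R (carrier G) z \<Longrightarrow> mz \<le> \<phi> g" using N_below[OF z] by blast
  obtain mx where mx: "\<And>g. g \<in> supp R (carrier G) x \<Longrightarrow> mx \<le> \<phi> g" using N_below[OF x] by blast
  have myz: "my + mz \<le> \<phi> k" if "k \<in> supp R (carrier G) (conv R G y z)" for k
  proof -
    from supp_conv[OF y z that] obtain h where h: "h \<in> supp R (carrier G) y" 
       "inv\<^bsub>G\<^esub> h \<otimes>\<^bsub>G\<^esub> k \<in> supp R (carrier G) z" by blast
    show ?thesis using my[OF h(1)] mz[OF h(2)] split[OF suppD[OF that] suppD[OF h(1)]] by simp
  qed
  define XX where "XX = low x (\<phi> g - my - mz + 1)"
  define YY where "YY = low y (\<phi> g - mx - mz + 1)"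
  define P where "P = (\<lambda>(h,k). h \<otimes>\<^bsub>G\<^esub> k) ` (XX \<times> YY)"
  have XX: "finite XX" "XX \<subseteq> carrier G" using low_finite[OF x] low_sub XX_def by auto
  have YY: "finite YY" "YY \<subseteq> carrier G" using low_finite[OF y] low_sub YY_def by auto
  have P: "finite P" "P \<subseteq> carrier G" using XX YY P_def by auto
  note cx = N_closed[OF x] and cy = N_closed[OF y] and cz = N_closed[OF z]
  have key: "h \<in> XX \<and> inv\<^bsub>G\<^esub> h \<otimes>\<^bsub>G\<^esub> p \<in> YY \<and> p \<in> P"
    if "p \<in> carrier G" "h \<in> supp R (carrier G) x" "inv\<^bsub>G\<^esub> h \<otimes>\<^bsub>G\<^esub> p \<in> supp R (carrier G) y"
      "inv\<^bsub>G\<^esub> p \<otimes>\<^bsub>G\<^esub> g \<in> supp R (carrier G) z" for h p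
  proof -
    have hc: "h \<in> carrier G" using that suppD by auto
    have e: "\<phi> g = \<phi> h + \<phi> (inv\<^bsub>G\<^esub> h \<otimes>\<^bsub>G\<^esub> p) + \<phi> (inv\<^bsub>G\<^esub> p \<otimes>\<^bsub>G\<^esub> g)"
      using split[OF g that(1)] split[OF that(1) hc] by simp
    have a: "h \<in> XX" "inv\<^bsub>G\<^esub> h \<otimes>\<^bsub>G\<^esub> p \<in> YY"
      unfolding XX_def YY_def low_def using that mx[OF that(2)] my[OF that(3)] mz[OF that(4)] e by auto
    have "p = h \<otimes>\<^bsub>G\<^esub> (inv\<^bsub>G\<^esub> h \<otimes>\<^bsub>G\<^esub> p)" using that hc by (simp add: G.m_assoc[symmetric])
    then have "p \<in> P" unfolding P_def using a by (intro image_eqI[of _ _ "(h, inv\<^bsub>G\<^esub> h \<otimes>\<^bsub>G\<^esub> p)"]) auto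
    with a show ?thesis by simp
  qed
  have L0: "conv R G (conv R G x y) z g = (\<Oplus>\<^bsub>R\<^esub>p\<in>P. conv R G x y p \<otimes>\<^bsub>R\<^esub> z (inv\<^bsub>G\<^esub> p \<otimes>\<^bsub>G\<^esub> g))"
  proof (rule conv_eq[OF xy z g P])
    fix p assume p: "p \<in> supp R (carrier G) (conv R G x y)" "inv\<^bsub>G\<^esub> p \<otimes>\<^bsub>G\<^esub> g \<in> supp R (carrier G) z"
    from supp_conv[OF x y p(1)] key suppD[OF p(1)] p(2) show "p \<in> P" by blast
  qed
  have L1: "conv R G x y p \<otimes>\<^bsub>R\<^esub> z (inv\<^bsub>G\<^esub> p \<otimes>\<^bsub>G\<^esub> g)
     = (\<Oplus>\<^bsub>R\<^esub>h\<in>XX. x h \<otimes>\<^bsub>R\<^esub> y (inv\<^bsub>G\<^esub> h \<otimes>\<^bsub>G\<^esub> p) \<otimes>\<^bsub>R\<^esub> z (inv\<^bsub>G\<^esub> p \<otimes>\<^bsub>G\<^esub> g))" if "p \<in> P" for p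
  proof (cases "z (inv\<^bsub>G\<^esub> p \<otimes>\<^bsub>G\<^esub> g) = \<zero>\<^bsub>R\<^esub>")
    case True
    have "(\<Oplus>\<^bsub>R\<^esub>h\<in>XX. x h \<otimes>\<^bsub>R\<^esub> y (inv\<^bsub>G\<^esub> h \<otimes>\<^bsub>G\<^esub> p) \<otimes>\<^bsub>R\<^esub> z (inv\<^bsub>G\<^esub> p \<otimes>\<^bsub>G\<^esub> g)) = \<zero>\<^bsub>R\<^esub>"
      using True XX P that cx cy by (intro R.add.finprod_one_eqI) (auto simp: subset_iff)
    then show ?thesis using True N_closed[OF xy] P that by auto
  next
    case False
    have pc: "p \<in> carrier G" using that P by auto
    have zs: "inv\<^bsub>G\<^esub> p \<otimes>\<^bsub>G\<^esub> g \<in> supp R (carrier G) z" using False pc g by (auto simp: supp_def)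
    have "conv R G x y p = (\<Oplus>\<^bsub>R\<^esub>h\<in>XX. x h \<otimes>\<^bsub>R\<^esub> y (inv\<^bsub>G\<^esub> h \<otimes>\<^bsub>G\<^esub> p))"
      by (rule conv_eq[OF x y pc XX]) (use key pc zs in blast)
    then show ?thesis
      using XX pc g cx cy cz by (simp add: R.finsum_ldistr subset_iff Pi_iff)
  qed
  have "conv R G (conv R G x y) z g =
     (\<Oplus>\<^bsub>R\<^esub>p\<in>P. \<Oplus>\<^bsub>R\<^esub>h\<in>XX. x h \<otimes>\<^bsub>R\<^esub> y (inv\<^bsub>G\<^esub> h \<otimes>\<^bsub>G\<^esub> p) \<otimes>\<^bsub>R\<^esub> z (inv\<^bsub>G\<^esub> p \<otimes>\<^bsub>G\<^esub> g))"
    unfolding L0 using XX P g cx cy cz L1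
    by (intro R.add.finprod_cong' refl) (auto intro!: R.finsum_closed simp: subset_iff)
  also have "\<dots> = (\<Oplus>\<^bsub>R\<^esub>h\<in>XX. \<Oplus>\<^bsub>R\<^esub>p\<in>P. x h \<otimes>\<^bsub>R\<^esub> y (inv\<^bsub>G\<^esub> h \<otimes>\<^bsub>G\<^esub> p) \<otimes>\<^bsub>R\<^esub> z (inv\<^bsub>G\<^esub> p \<otimes>\<^bsub>G\<^esub> g))"
    using XX P g cx cy cz by (intro R.finsum_swap) (auto simp: subset_iff)
  also have "\<dots> = (\<Oplus>\<^bsub>R\<^esub>h\<in>XX. x h \<otimes>\<^bsub>R\<^esub> conv R G y z (inv\<^bsub>G\<^esub> h \<otimes>\<^bsub>G\<^esub> g))"
  proof (intro R.add.finprod_cong' refl)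
    show "(\<lambda>h. x h \<otimes>\<^bsub>R\<^esub> conv R G y z (inv\<^bsub>G\<^esub> h \<otimes>\<^bsub>G\<^esub> g)) \<in> XX \<rightarrow> carrier R"
      using XX g cx N_closed[OF yz] by (auto simp: subset_iff)
  next
    fix h assume h: "h \<in> XX"
    then have hs: "h \<in> supp R (carrier G) x" "h \<in> carrier G" using XX by (auto simp: XX_def low_def)
    define Q where "Q = (\<lambda>p. inv\<^bsub>G\<^esub> h \<otimes>\<^bsub>G\<^esub> p) ` P"
    have Q: "finite Q" "Q \<subseteq> carrier G" using P hs by (auto simp: Q_def)
    have inj: "inj_on (\<lambda>p. inv\<^bsub>G\<^esub> h \<otimes>\<^bsub>G\<^esub> p) P" using P hs by (auto simp: inj_on_def subset_iff)
    have hg: "inv\<^bsub>G\<^esub> h \<otimes>\<^bsub>G\<^esub> g \<in> carrier G" using hs g by simp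
    have e: "inv\<^bsub>G\<^esub> (inv\<^bsub>G\<^esub> h \<otimes>\<^bsub>G\<^esub> p) \<otimes>\<^bsub>G\<^esub> (inv\<^bsub>G\<^esub> h \<otimes>\<^bsub>G\<^esub> g) = inv\<^bsub>G\<^esub> p \<otimes>\<^bsub>G\<^esub> g" if "p \<in> carrier G" for p
      using that hs g by (simp add: G.inv_mult_group G.m_assoc) (simp add: G.m_assoc[symmetric])
    have "conv R G y z (inv\<^bsub>G\<^esub> h \<otimes>\<^bsub>G\<^esub> g) =
       (\<Oplus>\<^bsub>R\<^esub>q\<in>Q. y q \<otimes>\<^bsub>R\<^esub> z (inv\<^bsub>G\<^esub> q \<otimes>\<^bsub>G\<^esub> (inv\<^bsub>G\<^esub> h \<otimes>\<^bsub>G\<^esub> g)))"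
    proof (rule conv_eq[OF y z hg Q])
      fix q assume q: "q \<in> supp R (carrier G) y"
        "inv\<^bsub>G\<^esub> q \<otimes>\<^bsub>G\<^esub> (inv\<^bsub>G\<^esub> h \<otimes>\<^bsub>G\<^esub> g) \<in> supp R (carrier G) z"
      have qc: "q \<in> carrier G" using q suppD by auto
      have q1: "inv\<^bsub>G\<^esub> h \<otimes>\<^bsub>G\<^esub> (h \<otimes>\<^bsub>G\<^esub> q) = q" using qc hs by (simp add: G.m_assoc[symmetric])
      have "h \<otimes>\<^bsub>G\<^esub> q \<in> P"
        using key[of "h \<otimes>\<^bsub>G\<^esub> q" h] q q1 qc hs e[of "h \<otimes>\<^bsub>G\<^esub> q"] by auto
      then show "q \<in> Q" unfolding Q_def using q1 by (intro image_eqI[of _ _ "h \<otimes>\<^bsub>G\<^esub> q"]) auto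
    qed
    also have "\<dots> = (\<Oplus>\<^bsub>R\<^esub>p\<in>P. y (inv\<^bsub>G\<^esub> h \<otimes>\<^bsub>G\<^esub> p) \<otimes>\<^bsub>R\<^esub> z (inv\<^bsub>G\<^esub> (inv\<^bsub>G\<^esub> h \<otimes>\<^bsub>G\<^esub> p) \<otimes>\<^bsub>G\<^esub> (inv\<^bsub>G\<^esub> h \<otimes>\<^bsub>G\<^esub> g)))"
      unfolding Q_def using P hs g cy cz inj by (intro R.finsum_reindex) (auto simp: subset_iff)
    also have "\<dots> = (\<Oplus>\<^bsub>R\<^esub>p\<in>P. y (inv\<^bsub>G\<^esub> h \<otimes>\<^bsub>G\<^esub> p) \<otimes>\<^bsub>R\<^esub> z (inv\<^bsub>G\<^esub> p \<otimes>\<^bsub>G\<^esub> g))"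
      using P hs g cy cz e by (intro R.add.finprod_cong' refl) (auto simp: subset_iff)
    finally have "x h \<otimes>\<^bsub>R\<^esub> conv R G y z (inv\<^bsub>G\<^esub> h \<otimes>\<^bsub>G\<^esub> g) = 
       (\<Oplus>\<^bsub>R\<^esub>p\<in>P. x h \<otimes>\<^bsub>R\<^esub> (y (inv\<^bsub>G\<^esub> h \<otimes>\<^bsub>G\<^esub> p) \<otimes>\<^bsub>R\<^esub> z (inv\<^bsub>G\<^esub> p \<otimes>\<^bsub>G\<^esub> g)))"
      using P hs g cx cy cz by (simp add: R.finsum_rdistr Pi_iff subset_iff)
    also have "\<dots> = (\<Oplus>\<^bsub>R\<^esub>p\<in>P. x h \<otimes>\<^bsub>R\<^esub> y (inv\<^bsub>G\<^esub> h \<otimes>\<^bsub>G\<^esub> p) \<otimes>\<^bsub>R\<^esub> z (inv\<^bsub>G\<^esub> p \<otimes>\<^bsub>G\<^esub> g))"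
      using P hs g cx cy cz by (intro R.add.finprod_cong' refl) (auto simp: subset_iff R.m_assoc)
    finally show "(\<Oplus>\<^bsub>R\<^esub>p\<in>P. x h \<otimes>\<^bsub>R\<^esub> y (inv\<^bsub>G\<^esub> h \<otimes>\<^bsub>G\<^esub> p) \<otimes>\<^bsub>R\<^esub> z (inv\<^bsub>G\<^esub> p \<otimes>\<^bsub>G\<^esub> g)) =
       x h \<otimes>\<^bsub>R\<^esub> conv R G y z (inv\<^bsub>G\<^esub> h \<otimes>\<^bsub>G\<^esub> g)" ..
  qed
  also have "\<dots> = conv R G x (conv R G y z) g"
    unfolding XX_def by (rule conv_low[OF x yz g myz, symmetric]) auto
  finally show "conv R G (conv R G x y) z g = conv R G x (conv R G y z) g" .
qed

abbreviation "one_N \<equiv> (\<lambda>g\<in>carrier G. if g = \<one>\<^bsub>G\<^esub> then \<one>\<^bsub>R\<^esub> else \<zero>\<^bsub>R\<^esub>)"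

lemma one_N: "one_N \<in> N"
proof -
  have "{g \<in> supp R (carrier G) one_N. \<phi> g < s} \<subseteq> {\<one>\<^bsub>G\<^esub>}" for s by (auto simp: supp_def split: if_splits)
  then show ?thesis by (auto simp: novikov_carrier_def intro: finite_subset)
qed

lemma add_N:
  assumes x: "x \<in> N" and y: "y \<in> N"
  shows "(\<lambda>g\<in>carrier G. x g \<oplus>\<^bsub>R\<^esub> y g) \<in> N"
proof -
  have "{g \<in> supp R (carrier G) (\<lambda>g\<in>carrier G. x g \<oplus>\<^bsub>R\<^esub> y g). \<phi> g < s} \<subseteq> low x s \<union> low y s" for s
    by (auto simp: supp_def low_def)
  then have "finite {g \<in> supp R (carrier G) (\<lambda>g\<in>carrier G. x g \<oplus>\<^bsub>R\<^esub> y g). \<phi> g < s}" for s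
    by (rule finite_subset) (use low_finite x y in auto)
  then show ?thesis using N_closed x y by (auto simp: novikov_carrier_def)
qed

lemma neg_N:
  assumes x: "x \<in> N"
  shows "(\<lambda>g\<in>carrier G. \<ominus>\<^bsub>R\<^esub> x g) \<in> N"
proof -
  have "{g \<in> supp R (carrier G) (\<lambda>g\<in>carrier G. \<ominus>\<^bsub>R\<^esub> x g). \<phi> g < s} \<subseteq> low x s" for s
    by (auto simp: supp_def low_def)
  then have "finite {g \<in> supp R (carrier G) (\<lambda>g\<in>carrier G. \<ominus>\<^bsub>R\<^esub> x g). \<phi> g < s}" for s
    by (rule finite_subset) (use low_finite x in auto)
  then show ?thesis using N_closed x by (auto simp: novikov_carrier_def)
qed

lemma zero_N: "(\<lambda>g\<in>carrier G. \<zero>\<^bsub>R\<^esub>) \<in> N"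
  by (auto simp: novikov_carrier_def supp_def)

lemma conv_one_l: assumes x: "x \<in> N" shows "conv R G one_N x = x"
proof (rule N_ext[OF conv_closed[OF one_N x] x])
  fix g assume g: "g \<in> carrier G"
  have "conv R G one_N x g = (\<Oplus>\<^bsub>R\<^esub>h\<in>{\<one>\<^bsub>G\<^esub>}. one_N h \<otimes>\<^bsub>R\<^esub> x (inv\<^bsub>G\<^esub> h \<otimes>\<^bsub>G\<^esub> g))"
    by (rule conv_eq[OF one_N x g]) (auto simp: supp_def split: if_splits)
  then show "conv R G one_N x g = x g" using N_closed[OF x g] g by simp
qed

lemma conv_one_r: assumes x: "x \<in> N" shows "conv R G x one_N = x"
proof (rule N_ext[OF conv_closed[OF x one_N] x])
  fix g assume g: "g \<in> carrier G"
  have "conv R G x one_N g = (\<Oplus>\<^bsub>R\<^esub>h\<in>{g}. x h \<otimes>\<^bsub>R\<^esub> one_N (inv\<^bsub>G\<^esub> h \<otimes>\<^bsub>G\<^esub> g))"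
    using g by (intro conv_eq[OF x one_N g]) (auto simp: supp_def G.inv_solve_left' split: if_splits)
  then show "conv R G x one_N g = x g" using N_closed[OF x g] g by simp
qed

lemma conv_l_distr:
  assumes x: "x \<in> N" and y: "y \<in> N" and z: "z \<in> N"
  shows "conv R G (\<lambda>g\<in>carrier G. x g \<oplus>\<^bsub>R\<^esub> y g) z = (\<lambda>g\<in>carrier G. conv R G x z g \<oplus>\<^bsub>R\<^esub> conv R G y z g)"
proof (rule N_ext[OF conv_closed[OF add_N[OF x y] z] add_N[OF conv_closed[OF x z] conv_closed[OF y z]]])
  fix g assume g: "g \<in> carrier G"
  obtain mz where mz: "\<And>g. g \<in> supp R (carrier G) z \<Longrightarrow> mz \<le> \<phi> g" using N_below[OF z] by blast
  define F where "F = low x (\<phi> g - mz + 1) \<union> low y (\<phi> g - mz + 1)"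
  have F: "finite F" "F \<subseteq> carrier G" using low_finite x y low_sub F_def by auto
  have m: "\<phi> h < \<phi> g - mz + 1" if "h \<in> carrier G" "inv\<^bsub>G\<^esub> h \<otimes>\<^bsub>G\<^esub> g \<in> supp R (carrier G) z" for h
    using split[OF g that(1)] mz[OF that(2)] by simp
  have cl: "h \<in> F \<Longrightarrow> h \<in> carrier G \<and> x h \<in> carrier R \<and> y h \<in> carrier R \<and> z (inv\<^bsub>G\<^esub> h \<otimes>\<^bsub>G\<^esub> g) \<in> carrier R" for h
    using F g N_closed x y z by auto
  have 1: "conv R G x z g = (\<Oplus>\<^bsub>R\<^esub>h\<in>F. x h \<otimes>\<^bsub>R\<^esub> z (inv\<^bsub>G\<^esub> h \<otimes>\<^bsub>G\<^esub> g))"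
    by (rule conv_eq[OF x z g F]) (use m suppD in \<open>auto simp: F_def low_def\<close>)
  have 2: "conv R G y z g = (\<Oplus>\<^bsub>R\<^esub>h\<in>F. y h \<otimes>\<^bsub>R\<^esub> z (inv\<^bsub>G\<^esub> h \<otimes>\<^bsub>G\<^esub> g))"
    by (rule conv_eq[OF y z g F]) (use m suppD in \<open>auto simp: F_def low_def\<close>)
  have "conv R G (\<lambda>g\<in>carrier G. x g \<oplus>\<^bsub>R\<^esub> y g) z g = (\<Oplus>\<^bsub>R\<^esub>h\<in>F. (\<lambda>g\<in>carrier G. x g \<oplus>\<^bsub>R\<^esub> y g) h \<otimes>\<^bsub>R\<^esub> z (inv\<^bsub>G\<^esub> h \<otimes>\<^bsub>G\<^esub> g))"
  proof (rule conv_eq[OF add_N[OF x y] z g F])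
    fix h assume h: "h \<in> supp R (carrier G) (\<lambda>g\<in>carrier G. x g \<oplus>\<^bsub>R\<^esub> y g)" "inv\<^bsub>G\<^esub> h \<otimes>\<^bsub>G\<^esub> g \<in> supp R (carrier G) z"
    show "h \<in> F" using h m[of h] by (auto simp: F_def low_def supp_def)
  qed
  also have "\<dots> = (\<Oplus>\<^bsub>R\<^esub>h\<in>F. x h \<otimes>\<^bsub>R\<^esub> z (inv\<^bsub>G\<^esub> h \<otimes>\<^bsub>G\<^esub> g) \<oplus>\<^bsub>R\<^esub> y h \<otimes>\<^bsub>R\<^esub> z (inv\<^bsub>G\<^esub> h \<otimes>\<^bsub>G\<^esub> g))"
    using cl by (intro R.add.finprod_cong' refl) (auto simp: R.l_distr)
  also have "\<dots> = conv R G x z g \<oplus>\<^bsub>R\<^esub> conv R G y z g"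
    unfolding 1 2 using cl by (intro R.finsum_addf) auto
  finally show "conv R G (\<lambda>g\<in>carrier G. x g \<oplus>\<^bsub>R\<^esub> y g) z g = (\<lambda>g\<in>carrier G. conv R G x z g \<oplus>\<^bsub>R\<^esub> conv R G y z g) g"
    using g by simp
qed

lemma conv_r_distr:
  assumes x: "x \<in> N" and y: "y \<in> N" and z: "z \<in> N"
  shows "conv R G z (\<lambda>g\<in>carrier G. x g \<oplus>\<^bsub>R\<^esub> y g) = (\<lambda>g\<in>carrier G. conv R G z x g \<oplus>\<^bsub>R\<^esub> conv R G z y g)"
proof (rule N_ext[OF conv_closed[OF z add_N[OF x y]] add_N[OF conv_closed[OF z x] conv_closed[OF z y]]])
  fix g assume g: "g \<in> carrier G"
  obtain mx where mx: "\<And>g. g \<in> supp R (carrier G) x \<Longrightarrow> mx \<le> \<phi> g" using N_below[OF x] by blast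
  obtain my where my: "\<And>g. g \<in> supp R (carrier G) y \<Longrightarrow> my \<le> \<phi> g" using N_below[OF y] by blast
  define F where "F = low z (\<phi> g - min mx my + 1)"
  have F: "finite F" "F \<subseteq> carrier G" using low_finite z low_sub F_def by auto
  have m: "\<phi> h < \<phi> g - min mx my + 1" if "h \<in> carrier G" "inv\<^bsub>G\<^esub> h \<otimes>\<^bsub>G\<^esub> g \<in> supp R (carrier G) x \<union> supp R (carrier G) y" for h
    using split[OF g that(1)] mx my that(2) by fastforce
  have cl: "h \<in> F \<Longrightarrow> h \<in> carrier G \<and> z h \<in> carrier R \<and> y (inv\<^bsub>G\<^esub> h \<otimes>\<^bsub>G\<^esub> g) \<in> carrier R \<and> x (inv\<^bsub>G\<^esub> h \<otimes>\<^bsub>G\<^esub> g) \<in> carrier R" for h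
    using F g N_closed x y z by auto
  have 1: "conv R G z x g = (\<Oplus>\<^bsub>R\<^esub>h\<in>F. z h \<otimes>\<^bsub>R\<^esub> x (inv\<^bsub>G\<^esub> h \<otimes>\<^bsub>G\<^esub> g))"
    by (rule conv_eq[OF z x g F]) (use m suppD in \<open>auto simp: F_def low_def\<close>)
  have 2: "conv R G z y g = (\<Oplus>\<^bsub>R\<^esub>h\<in>F. z h \<otimes>\<^bsub>R\<^esub> y (inv\<^bsub>G\<^esub> h \<otimes>\<^bsub>G\<^esub> g))"
    by (rule conv_eq[OF z y g F]) (use m suppD in \<open>auto simp: F_def low_def\<close>)
  have "conv R G z (\<lambda>g\<in>carrier G. x g \<oplus>\<^bsub>R\<^esub> y g) g = (\<Oplus>\<^bsub>R\<^esub>h\<in>F. z h \<otimes>\<^bsub>R\<^esub> (\<lambda>g\<in>carrier G. x g \<oplus>\<^bsub>R\<^esub> y g) (inv\<^bsub>G\<^esub> h \<otimes>\<^bsub>G\<^esub> g))"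
  proof (rule conv_eq[OF z add_N[OF x y] g F])
    fix h assume h: "h \<in> supp R (carrier G) z" "inv\<^bsub>G\<^esub> h \<otimes>\<^bsub>G\<^esub> g \<in> supp R (carrier G) (\<lambda>g\<in>carrier G. x g \<oplus>\<^bsub>R\<^esub> y g)"
    have "inv\<^bsub>G\<^esub> h \<otimes>\<^bsub>G\<^esub> g \<in> supp R (carrier G) x \<union> supp R (carrier G) y"
      using h(2) by (auto simp: supp_def)
    then show "h \<in> F" using h(1) m[OF suppD[OF h(1)]] by (auto simp: F_def low_def)
  qed
  also have "\<dots> = (\<Oplus>\<^bsub>R\<^esub>h\<in>F. z h \<otimes>\<^bsub>R\<^esub> x (inv\<^bsub>G\<^esub> h \<otimes>\<^bsub>G\<^esub> g) \<oplus>\<^bsub>R\<^esub> z h \<otimes>\<^bsub>R\<^esub> y (inv\<^bsub>G\<^esub> h \<otimes>\<^bsub>G\<^esub> g))"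
    using cl g by (intro R.add.finprod_cong' refl) (auto simp: R.r_distr)
  also have "\<dots> = conv R G z x g \<oplus>\<^bsub>R\<^esub> conv R G z y g"
    unfolding 1 2 using cl by (intro R.finsum_addf) auto
  finally show "conv R G z (\<lambda>g\<in>carrier G. x g \<oplus>\<^bsub>R\<^esub> y g) g = (\<lambda>g\<in>carrier G. conv R G z x g \<oplus>\<^bsub>R\<^esub> conv R G z y g) g"
    using g by simp
qed

lemma ring_novikov: "ring (novikov_ring R G \<phi>)"
proof (rule ringI)
  show "abelian_group (novikov_ring R G \<phi>)"
  proof (rule abelian_groupI)
    fix x assume x: "x \<in> carrier (novikov_ring R G \<phi>)"
    then have x': "x \<in> N" by (simp add: novikov_ring_def)
    show "\<exists>y\<in>carrier (novikov_ring R G \<phi>). y \<oplus>\<^bsub>novikov_ring R G \<phi>\<^esub> x = \<zero>\<^bsub>novikov_ring R G \<phi>\<^esub>"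
      using N_closed[OF x']
      by (intro bexI[of _ "\<lambda>g\<in>carrier G. \<ominus>\<^bsub>R\<^esub> x g"])
        (auto simp: novikov_ring_def neg_N[OF x'] R.l_neg intro!: restrict_ext)
    show "\<zero>\<^bsub>novikov_ring R G \<phi>\<^esub> \<oplus>\<^bsub>novikov_ring R G \<phi>\<^esub> x = x"
      using N_ext[OF add_N[OF zero_N x'] x'] N_closed[OF x'] by (simp add: novikov_ring_def)
  qed (auto simp: novikov_ring_def zero_N add_N N_closed R.a_ac intro!: restrict_ext)
  show "monoid (novikov_ring R G \<phi>)"
    by (rule monoidI) (auto simp: novikov_ring_def one_N conv_closed conv_assoc conv_one_l conv_one_r)
qed (auto simp: novikov_ring_def conv_l_distr conv_r_distr)

lemma subring_group_ring: "subring (group_ring R G) (novikov_ring R G \<phi>)"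
proof -
  interpret A: ring "novikov_ring R G \<phi>" by (rule ring_novikov)
  have sub: "group_ring R G \<subseteq> N"
    by (auto simp: group_ring_def novikov_carrier_def)
  have iff: "x \<in> group_ring R G \<longleftrightarrow> x \<in> N \<and> finite (supp R (carrier G) x)" for x
    using sub by (auto simp: group_ring_def novikov_carrier_def)
  show ?thesis
  proof (rule A.subringI)
    show "group_ring R G \<subseteq> carrier (novikov_ring R G \<phi>)" using sub by (simp add: novikov_ring_def)
    have "supp R (carrier G) one_N \<subseteq> {\<one>\<^bsub>G\<^esub>}" by (auto simp: supp_def split: if_splits)
    then show "\<one>\<^bsub>novikov_ring R G \<phi>\<^esub> \<in> group_ring R G"
      using one_N finite_subset by (auto simp: iff novikov_ring_def)
  next
    fix x assume x: "x \<in> group_ring R G"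
    then have x': "x \<in> N" using sub by auto
    have "\<ominus>\<^bsub>novikov_ring R G \<phi>\<^esub> x = (\<lambda>g\<in>carrier G. \<ominus>\<^bsub>R\<^esub> x g)"
      using N_closed[OF x'] x' neg_N[OF x']
      by (intro A.minus_equality) (auto simp: novikov_ring_def R.l_neg intro!: restrict_ext)
    moreover have "supp R (carrier G) (\<lambda>g\<in>carrier G. \<ominus>\<^bsub>R\<^esub> x g) \<subseteq> supp R (carrier G) x"
      by (auto simp: supp_def)
    ultimately show "\<ominus>\<^bsub>novikov_ring R G \<phi>\<^esub> x \<in> group_ring R G"
      using x neg_N[OF x'] finite_subset by (auto simp: iff)
  next
    fix x y assume x: "x \<in> group_ring R G" and y: "y \<in> group_ring R G"
    then have x': "x \<in> N" and y': "y \<in> N" using sub by auto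
    have "supp R (carrier G) (\<lambda>g\<in>carrier G. x g \<oplus>\<^bsub>R\<^esub> y g) \<subseteq> supp R (carrier G) x \<union> supp R (carrier G) y"
      by (auto simp: supp_def)
    moreover have "finite (supp R (carrier G) x \<union> supp R (carrier G) y)" using x y by (auto simp: iff)
    ultimately show "x \<oplus>\<^bsub>novikov_ring R G \<phi>\<^esub> y \<in> group_ring R G"
      using add_N[OF x' y'] finite_subset by (auto simp: iff novikov_ring_def)
    have "supp R (carrier G) (conv R G x y) \<subseteq> (\<lambda>(h,k). h \<otimes>\<^bsub>G\<^esub> k) ` (supp R (carrier G) x \<times> supp R (carrier G) y)"
    proof
      fix g assume g: "g \<in> supp R (carrier G) (conv R G x y)"
      from supp_conv[OF x' y' g] obtain h where h: "h \<in> supp R (carrier G) x"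
        "inv\<^bsub>G\<^esub> h \<otimes>\<^bsub>G\<^esub> g \<in> supp R (carrier G) y" by blast
      have "g = h \<otimes>\<^bsub>G\<^esub> (inv\<^bsub>G\<^esub> h \<otimes>\<^bsub>G\<^esub> g)" using suppD[OF g] suppD[OF h(1)] by (simp add: G.m_assoc[symmetric])
      then show "g \<in> (\<lambda>(h,k). h \<otimes>\<^bsub>G\<^esub> k) ` (supp R (carrier G) x \<times> supp R (carrier G) y)"
        using h by (intro image_eqI[of _ _ "(h, inv\<^bsub>G\<^esub> h \<otimes>\<^bsub>G\<^esub> g)"]) auto
    qed
    moreover have "finite ((\<lambda>(h,k). h \<otimes>\<^bsub>G\<^esub> k) ` (supp R (carrier G) x \<times> supp R (carrier G) y))"
      using x y by (auto simp: iff)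
    ultimately show "x \<otimes>\<^bsub>novikov_ring R G \<phi>\<^esub> y \<in> group_ring R G"
      using conv_closed[OF x' y'] finite_subset by (auto simp: iff novikov_ring_def)
  qed
qed

end

lemma division_closed_closure:
  assumes "ring A" "S \<subseteq> carrier A"
  shows "division_closed A (division_closure A S)" "S \<subseteq> division_closure A S"
proof -
  interpret ring A by fact
  have c: "division_closed A (carrier A)"
    using carrier_is_subring by (auto simp: division_closed_def Units_def)
  have s: "subring (division_closure A S) A"
    unfolding division_closure_def
  proof (rule subring_Inter)
    show "{T. division_closed A T \<and> S \<subseteq> T} \<noteq> {}" using c assms(2) by blast
  qed (simp add: division_closed_def)
  show "S \<subseteq> division_closure A S" by (auto simp: division_closure_def)
  have "x \<in> Units (A\<lparr>carrier := division_closure A S\<rparr>)"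
    if x: "x \<in> division_closure A S" "x \<in> Units A" for x
  proof -
    have "inv\<^bsub>A\<^esub> x \<in> T" if T: "division_closed A T" "S \<subseteq> T" for T
    proof -
      have "x \<in> T" using x(1) T unfolding division_closure_def by blast
      then have "x \<in> Units (A\<lparr>carrier := T\<rparr>)" using x(2) T(1) unfolding division_closed_def by blast
      then obtain y where y: "y \<in> T" "y \<otimes>\<^bsub>A\<^esub> x = \<one>\<^bsub>A\<^esub>" "x \<otimes>\<^bsub>A\<^esub> y = \<one>\<^bsub>A\<^esub>"
        unfolding Units_def by auto
      have "T \<subseteq> carrier A" using T(1) subringE(1) unfolding division_closed_def by blast
      then have "y \<in> carrier A" using y(1) by blast
      then have "inv\<^bsub>A\<^esub> x = y" using inv_unique'[OF Units_closed[OF x(2)] _ y(3,2)] by simp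
      then show ?thesis using y(1) by simp
    qed
    then have "inv\<^bsub>A\<^esub> x \<in> division_closure A S" unfolding division_closure_def by blast
    then show ?thesis
      using x Units_l_inv[OF x(2)] Units_r_inv[OF x(2)] unfolding Units_def[of "A\<lparr>carrier := _\<rparr>"]
      by (auto intro!: bexI[of _ "inv\<^bsub>A\<^esub> x"])
  qed
  then show "division_closed A (division_closure A S)" using s unfolding division_closed_def by blast
qed

end

theory Submission
  imports Defs
begin

text \<open>
  Write \<open>e = H\<^sub>n\<^sub>-\<^sub>1 \<partial>\<^sub>n\<close>. The relations \<open>e \<partial>\<^sub>n\<^sub>+\<^sub>1 = 0\<close> and \<open>e + \<partial>\<^sub>n\<^sub>+\<^sub>1 H\<^sub>n = id\<close> make
  \<open>e\<close> an idempotent, defined over \<open>\<D>\<close>. Cutting off every coefficient of \<open>H\<^sub>n\<close> above a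
  sufficiently high value of \<open>\<phi>\<close> gives a homomorphism \<open>H'\<close> defined over \<open>RG\<close> for which
  \<open>e + \<partial>\<^sub>n\<^sub>+\<^sub>1 H' = id - U\<close>, where the entries of \<open>U = \<partial>\<^sub>n\<^sub>+\<^sub>1 (H\<^sub>n - H')\<close> are supported
  where \<open>\<phi> \<ge> 1\<close>. The entries of \<open>U\<close> lie in \<open>\<D>\<close> as well, although \<open>H\<^sub>n\<close> has entries in the
  larger ring, because \<open>U = id - e - \<partial>\<^sub>n\<^sub>+\<^sub>1 H'\<close>.

  If \<open>id - U\<close> has a right inverse \<open>V\<close> over \<open>\<D>\<close>, then \<open>H\<^sub>n' = H' V\<close> is as required:
  multiplying \<open>(e + \<partial>\<^sub>n\<^sub>+\<^sub>1 H') V = id\<close> by \<open>e\<close> on the left gives \<open>e V = e\<close>, and therefore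
  \<open>e + \<partial>\<^sub>n\<^sub>+\<^sub>1 H' V = id\<close>.

  It remains to find \<open>V\<close>. The geometric series inverts \<open>id - U\<close> only over the
  Novikov--Sikorav ring, and division closedness concerns elements, not matrices. For a single \<open>u\<close> supported
  where \<open>\<phi> \<ge> 1\<close>, the geometric series inverts \<open>1 - u\<close> in the Novikov--Sikorav ring
  (\<open>one_minus_filt_unit\<close>), so for \<open>u\<close> in \<open>\<D>\<close> the inverse lies in \<open>\<D>\<close>. Gaussian elimination
  then reduces the matrix case to this one (\<open>quasi_regular_system_solvable\<close>): all pivots
  have the form \<open>1 - u\<close>, because eliminating one row changes the other entries only by
  products of two entries of \<open>U\<close> with the inverse of a pivot in between, and these are
  again supported where \<open>\<phi> \<ge> 1\<close>.

  Matrices appear as linear systems: the columns of \<open>V\<close> are found one at a time, each as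
  the solution of a system, and \<open>H\<^sub>n'\<close> is obtained by prescribing its values on the
  basis (\<open>ex_homotopy_value_in_basis_span\<close>).
\<close>


section \<open>The filtration of the Novikov--Sikorav ring by the values of the character\<close>

context novikov
begin

abbreviation "Nov \<equiv> novikov_ring R G \<phi>"

lemma Nov_carrier: "carrier Nov = N"
  by (simp add: novikov_ring_def)

lemma Nov_minus_apply:
  assumes x: "x \<in> N" and y: "y \<in> N" and g: "g \<in> carrier G"
  shows "(x \<ominus>\<^bsub>Nov\<^esub> y) g = x g \<ominus>\<^bsub>R\<^esub> y g"
proof -
  interpret A: ring Nov by (rule ring_novikov)
  have "\<ominus>\<^bsub>Nov\<^esub> y = (\<lambda>g\<in>carrier G. \<ominus>\<^bsub>R\<^esub> y g)"
    using N_closed[OF y] y neg_N[OF y]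
    by (intro A.minus_equality) (auto simp: novikov_ring_def R.l_neg intro!: restrict_ext)
  then show ?thesis
    using g by (simp add: a_minus_def novikov_ring_def)
qed

text \<open>The elements supported where \<open>\<phi> \<ge> s\<close>. These subgroups form the decreasing filtration
  for which the Novikov--Sikorav ring is the completion of the group ring.\<close>

definition filt :: "real \<Rightarrow> ('g \<Rightarrow> 'r) set" where
  "filt s = {x \<in> N. \<forall>g\<in>carrier G. \<phi> g < s \<longrightarrow> x g = \<zero>\<^bsub>R\<^esub>}"

lemma filt_subset: "filt s \<subseteq> N"
  by (auto simp: filt_def)

lemma filt_antimono: "s \<le> t \<Longrightarrow> filt t \<subseteq> filt s"
  by (auto simp: filt_def)

text \<open>Closeness in the filtration is agreement of coefficients. This turns convergence
  statements into pointwise ones.\<close>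

lemma minus_in_filt_iff:
  assumes x: "x \<in> N" and y: "y \<in> N"
  shows "x \<ominus>\<^bsub>Nov\<^esub> y \<in> filt s \<longleftrightarrow> (\<forall>g\<in>carrier G. \<phi> g < s \<longrightarrow> x g = y g)"
proof -
  interpret A: ring Nov by (rule ring_novikov)
  have "x \<ominus>\<^bsub>Nov\<^esub> y \<in> N" using A.minus_closed[of x y] x y by (simp add: Nov_carrier)
  moreover have "(x \<ominus>\<^bsub>Nov\<^esub> y) g = \<zero>\<^bsub>R\<^esub> \<longleftrightarrow> x g = y g" if "g \<in> carrier G" for g
    using that N_closed[OF x] N_closed[OF y] by (simp add: Nov_minus_apply[OF x y])
  ultimately show ?thesis by (auto simp: filt_def)
qed

lemma additive_subgroup_filt: "additive_subgroup (filt s) Nov"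
proof (intro additive_subgroup.intro)
  interpret A: ring Nov by (rule ring_novikov)
  show "subgroup (filt s) (add_monoid Nov)"
  proof (rule A.add.subgroupI)
    show "filt s \<subseteq> carrier Nov" using filt_subset by (simp add: Nov_carrier)
    have "\<zero>\<^bsub>Nov\<^esub> \<in> filt s" using zero_N by (simp add: filt_def novikov_ring_def)
    then show "filt s \<noteq> {}" by blast
    show "\<ominus>\<^bsub>Nov\<^esub> x \<in> filt s" if x: "x \<in> filt s" for x
    proof -
      have "\<zero>\<^bsub>Nov\<^esub> \<ominus>\<^bsub>Nov\<^esub> x \<in> filt s"
        using x zero_N filt_subset
        by (subst minus_in_filt_iff) (auto simp: novikov_ring_def filt_def)
      moreover have "x \<in> carrier Nov" using x filt_subset by (auto simp: Nov_carrier)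
      ultimately show ?thesis by (simp add: a_minus_def)
    qed
    show "x \<oplus>\<^bsub>Nov\<^esub> y \<in> filt s" if "x \<in> filt s" "y \<in> filt s" for x y
      using that add_N by (auto simp: novikov_ring_def filt_def)
  qed
qed

lemma filt_mult:
  assumes x: "x \<in> filt s" and y: "y \<in> filt t"
  shows "x \<otimes>\<^bsub>Nov\<^esub> y \<in> filt (s + t)"
proof -
  have N: "x \<in> N" "y \<in> N" using x y filt_subset by auto
  have "conv R G x y g = \<zero>\<^bsub>R\<^esub>" if g: "g \<in> carrier G" "\<phi> g < s + t" for g
  proof (rule ccontr)
    assume "conv R G x y g \<noteq> \<zero>\<^bsub>R\<^esub>"
    then have "g \<in> supp R (carrier G) (conv R G x y)" using g by (simp add: supp_def)
    from supp_conv[OF N this] obtain h where h: "h \<in> supp R (carrier G) x"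
      "inv\<^bsub>G\<^esub> h \<otimes>\<^bsub>G\<^esub> g \<in> supp R (carrier G) y" by blast
    then have "s \<le> \<phi> h" "t \<le> \<phi> (inv\<^bsub>G\<^esub> h \<otimes>\<^bsub>G\<^esub> g)"
      using x y by (force simp: filt_def supp_def)+
    then show False using split[OF g(1) suppD[OF h(1)]] g(2) by simp
  qed
  then show ?thesis using conv_closed[OF N] by (simp add: filt_def novikov_ring_def)
qed

lemma ex_filt:
  assumes "x \<in> N" obtains s where "x \<in> filt s"
proof -
  obtain m where "\<And>g. g \<in> supp R (carrier G) x \<Longrightarrow> m \<le> \<phi> g" using N_below[OF assms] by blast
  then have "x \<in> filt m" using assms by (force simp: filt_def supp_def)
  then show thesis by (rule that)
qed

text \<open>The group ring is dense: below any bound on \<open>\<phi>\<close> an element of the Novikov--Sikorav ring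
  has only finitely many nonzero coefficients, and these form an element of the group ring.\<close>

lemma group_ring_approx:
  assumes x: "x \<in> N"
  obtains y where "y \<in> group_ring R G" "x \<ominus>\<^bsub>Nov\<^esub> y \<in> filt s"
proof -
  define y where "y = (\<lambda>g\<in>carrier G. if \<phi> g < s then x g else \<zero>\<^bsub>R\<^esub>)"
  have "supp R (carrier G) y \<subseteq> low x s"
    by (auto simp: y_def supp_def low_def split: if_splits)
  then have "finite (supp R (carrier G) y)" using low_finite[OF x] finite_subset by blast
  then have y: "y \<in> group_ring R G"
    using N_closed[OF x] by (auto simp: group_ring_def y_def)
  then have "y \<in> N" by (auto simp: group_ring_def novikov_carrier_def)
  then have "x \<ominus>\<^bsub>Nov\<^esub> y \<in> filt s"
    using x by (subst minus_in_filt_iff) (auto simp: y_def)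
  with y show thesis by (rule that)
qed

text \<open>The contraction principle for the complete filtration. The iterates of \<open>F\<close> stabilise at
  each group element, since the \<open>n\<close>-th and all later ones agree where \<open>\<phi> < n\<close>. Below any
  bound the limit agrees with one iterate, so it satisfies the finiteness condition again.\<close>

lemma contraction_fixpoint:
  assumes cl: "\<And>x. x \<in> N \<Longrightarrow> F x \<in> N"
    and contr: "\<And>x y s. x \<in> N \<Longrightarrow> y \<in> N \<Longrightarrow> x \<ominus>\<^bsub>Nov\<^esub> y \<in> filt s \<Longrightarrow> F x \<ominus>\<^bsub>Nov\<^esub> F y \<in> filt (s + 1)"
    and x0: "x\<^sub>0 \<in> N" "F x\<^sub>0 \<ominus>\<^bsub>Nov\<^esub> x\<^sub>0 \<in> filt 0"
  obtains x where "x \<in> N" "F x = x" "x \<ominus>\<^bsub>Nov\<^esub> x\<^sub>0 \<in> filt 0"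
proof -
  define S where "S n = (F ^^ n) x\<^sub>0" for n
  have S_N: "S n \<in> N" for n by (induction n) (auto simp: S_def x0 cl)
  have "S (Suc n) \<ominus>\<^bsub>Nov\<^esub> S n \<in> filt (real n)" for n
  proof (induction n)
    case 0 then show ?case using x0 by (simp add: S_def)
  next
    case (Suc n)
    from contr[OF S_N S_N Suc] show ?case by (simp add: S_def add.commute)
  qed
  then have step: "S (Suc n) g = S n g" if "g \<in> carrier G" "\<phi> g < real n" for n g
    using that S_N minus_in_filt_iff by blast
  have stable: "S m g = S n g" if "n \<le> m" "g \<in> carrier G" "\<phi> g < real n" for m n g
    using that(1)
  proof (induction m rule: dec_induct)
    case (step m)
    then show ?case using \<open>\<And>n g. g \<in> carrier G \<Longrightarrow> \<phi> g < real n \<Longrightarrow> S (Suc n) g = S n g\<close>[of g m] that(2,3)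
      by simp
  qed simp
  define x where "x = (\<lambda>g\<in>carrier G. S (nat (\<lfloor>\<phi> g\<rfloor> + 1)) g)"
  have x_S: "x g = S n g" if g: "g \<in> carrier G" "\<phi> g < real n" for n g
  proof -
    have "nat (\<lfloor>\<phi> g\<rfloor> + 1) \<le> n" using g(2) by linarith
    moreover have "\<phi> g < real (nat (\<lfloor>\<phi> g\<rfloor> + 1))" by linarith
    ultimately show ?thesis using stable[of _ n g] g(1) by (simp add: x_def)
  qed
  have x: "x \<in> N"
  proof -
    have "finite {g \<in> supp R (carrier G) x. \<phi> g < s}" for s
    proof -
      obtain n :: nat where n: "s < real n" using reals_Archimedean2 by blast
      have "{g \<in> supp R (carrier G) x. \<phi> g < s} \<subseteq> low (S n) s"
        using x_S[of _ n] n by (auto simp: supp_def low_def)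
      then show ?thesis using low_finite[OF S_N] finite_subset by blast
    qed
    then show ?thesis using N_closed[OF S_N] by (auto simp: novikov_carrier_def x_def)
  qed
  have x_minus_S: "x \<ominus>\<^bsub>Nov\<^esub> S n \<in> filt (real n)" for n
    using x_S by (simp add: minus_in_filt_iff x S_N)
  have "F x = x"
  proof (rule N_ext[OF cl[OF x] x])
    fix g assume g: "g \<in> carrier G"
    obtain n :: nat where n: "\<phi> g < real n" using reals_Archimedean2 by blast
    have "F x \<ominus>\<^bsub>Nov\<^esub> S (Suc n) \<in> filt (real n + 1)"
      using contr[OF x S_N x_minus_S, of n] by (simp add: S_def)
    then have "F x g = S (Suc n) g"
      using g n by (simp add: minus_in_filt_iff cl x S_N)
    then show "F x g = x g" using x_S[of g "Suc n"] g n by simp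
  qed
  moreover have "x \<ominus>\<^bsub>Nov\<^esub> x\<^sub>0 \<in> filt 0" using x_minus_S[of 0] by (simp add: S_def)
  ultimately show thesis using x that by blast
qed

text \<open>The geometric series, as the fixed point of the contraction \<open>x \<mapsto> 1 + u x\<close>. It yields a
  right inverse only; the contraction \<open>x \<mapsto> 1 + x u\<close> yields a left inverse, and the two agree.\<close>

lemma one_minus_filt_unit:
  assumes u: "u \<in> filt 1"
  obtains t where "t \<in> filt 0" "(\<one>\<^bsub>Nov\<^esub> \<ominus>\<^bsub>Nov\<^esub> u) \<otimes>\<^bsub>Nov\<^esub> t = \<one>\<^bsub>Nov\<^esub>" "t \<otimes>\<^bsub>Nov\<^esub> (\<one>\<^bsub>Nov\<^esub> \<ominus>\<^bsub>Nov\<^esub> u) = \<one>\<^bsub>Nov\<^esub>"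
proof -
  interpret A: ring Nov by (rule ring_novikov)
  have uN: "u \<in> carrier Nov" using u filt_subset by (auto simp: Nov_carrier)
  have one: "\<one>\<^bsub>Nov\<^esub> \<in> filt 0"
    using one_N phi_one by (auto simp: filt_def novikov_ring_def)
  have zero_diff: "x \<ominus>\<^bsub>Nov\<^esub> \<zero>\<^bsub>Nov\<^esub> = x" if "x \<in> carrier Nov" for x
    using that by (simp add: a_minus_def)
  obtain t where t: "t \<in> N" "\<one>\<^bsub>Nov\<^esub> \<oplus>\<^bsub>Nov\<^esub> u \<otimes>\<^bsub>Nov\<^esub> t = t" "t \<ominus>\<^bsub>Nov\<^esub> \<zero>\<^bsub>Nov\<^esub> \<in> filt 0"
  proof (rule contraction_fixpoint[of "\<lambda>x. \<one>\<^bsub>Nov\<^esub> \<oplus>\<^bsub>Nov\<^esub> u \<otimes>\<^bsub>Nov\<^esub> x" "\<zero>\<^bsub>Nov\<^esub>"])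
    fix x y s assume *: "x \<in> N" "y \<in> N" "x \<ominus>\<^bsub>Nov\<^esub> y \<in> filt s"
    have "(\<one>\<^bsub>Nov\<^esub> \<oplus>\<^bsub>Nov\<^esub> u \<otimes>\<^bsub>Nov\<^esub> x) \<ominus>\<^bsub>Nov\<^esub> (\<one>\<^bsub>Nov\<^esub> \<oplus>\<^bsub>Nov\<^esub> u \<otimes>\<^bsub>Nov\<^esub> y) = u \<otimes>\<^bsub>Nov\<^esub> (x \<ominus>\<^bsub>Nov\<^esub> y)"
      using * uN by (simp add: Nov_carrier[symmetric]) algebra
    then show "(\<one>\<^bsub>Nov\<^esub> \<oplus>\<^bsub>Nov\<^esub> u \<otimes>\<^bsub>Nov\<^esub> x) \<ominus>\<^bsub>Nov\<^esub> (\<one>\<^bsub>Nov\<^esub> \<oplus>\<^bsub>Nov\<^esub> u \<otimes>\<^bsub>Nov\<^esub> y) \<in> filt (s + 1)"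
      using filt_mult[OF u *(3)] by (simp add: add.commute)
  qed (use uN one in \<open>auto simp: Nov_carrier[symmetric] zero_diff\<close>)
  obtain t' where t': "t' \<in> N" "\<one>\<^bsub>Nov\<^esub> \<oplus>\<^bsub>Nov\<^esub> t' \<otimes>\<^bsub>Nov\<^esub> u = t'"
  proof (rule contraction_fixpoint[of "\<lambda>x. \<one>\<^bsub>Nov\<^esub> \<oplus>\<^bsub>Nov\<^esub> x \<otimes>\<^bsub>Nov\<^esub> u" "\<zero>\<^bsub>Nov\<^esub>"])
    fix x y s assume *: "x \<in> N" "y \<in> N" "x \<ominus>\<^bsub>Nov\<^esub> y \<in> filt s"
    have "(\<one>\<^bsub>Nov\<^esub> \<oplus>\<^bsub>Nov\<^esub> x \<otimes>\<^bsub>Nov\<^esub> u) \<ominus>\<^bsub>Nov\<^esub> (\<one>\<^bsub>Nov\<^esub> \<oplus>\<^bsub>Nov\<^esub> y \<otimes>\<^bsub>Nov\<^esub> u) = (x \<ominus>\<^bsub>Nov\<^esub> y) \<otimes>\<^bsub>Nov\<^esub> u"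
      using * uN by (simp add: Nov_carrier[symmetric]) algebra
    then show "(\<one>\<^bsub>Nov\<^esub> \<oplus>\<^bsub>Nov\<^esub> x \<otimes>\<^bsub>Nov\<^esub> u) \<ominus>\<^bsub>Nov\<^esub> (\<one>\<^bsub>Nov\<^esub> \<oplus>\<^bsub>Nov\<^esub> y \<otimes>\<^bsub>Nov\<^esub> u) \<in> filt (s + 1)"
      using filt_mult[OF *(3) u] by simp
  qed (use uN one in \<open>auto simp: Nov_carrier[symmetric] zero_diff\<close>)
  have c: "t \<in> carrier Nov" "t' \<in> carrier Nov" using t t' by (auto simp: Nov_carrier)
  have R: "(\<one>\<^bsub>Nov\<^esub> \<ominus>\<^bsub>Nov\<^esub> u) \<otimes>\<^bsub>Nov\<^esub> t = \<one>\<^bsub>Nov\<^esub>"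
  proof -
    have "(\<one>\<^bsub>Nov\<^esub> \<ominus>\<^bsub>Nov\<^esub> u) \<otimes>\<^bsub>Nov\<^esub> t = t \<ominus>\<^bsub>Nov\<^esub> u \<otimes>\<^bsub>Nov\<^esub> t" using c uN by algebra
    also have "\<dots> = (\<one>\<^bsub>Nov\<^esub> \<oplus>\<^bsub>Nov\<^esub> u \<otimes>\<^bsub>Nov\<^esub> t) \<ominus>\<^bsub>Nov\<^esub> u \<otimes>\<^bsub>Nov\<^esub> t" by (simp add: t(2))
    also have "\<dots> = \<one>\<^bsub>Nov\<^esub>" using c uN by algebra
    finally show ?thesis .
  qed
  have L: "t' \<otimes>\<^bsub>Nov\<^esub> (\<one>\<^bsub>Nov\<^esub> \<ominus>\<^bsub>Nov\<^esub> u) = \<one>\<^bsub>Nov\<^esub>"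
  proof -
    have "t' \<otimes>\<^bsub>Nov\<^esub> (\<one>\<^bsub>Nov\<^esub> \<ominus>\<^bsub>Nov\<^esub> u) = t' \<ominus>\<^bsub>Nov\<^esub> t' \<otimes>\<^bsub>Nov\<^esub> u" using c uN by (simp add: a_minus_def A.r_distr A.r_minus)
    also have "\<dots> = (\<one>\<^bsub>Nov\<^esub> \<oplus>\<^bsub>Nov\<^esub> t' \<otimes>\<^bsub>Nov\<^esub> u) \<ominus>\<^bsub>Nov\<^esub> t' \<otimes>\<^bsub>Nov\<^esub> u" by (simp add: t'(2))
    also have "\<dots> = \<one>\<^bsub>Nov\<^esub>" using c uN by algebra
    finally show ?thesis .
  qed
  have "t' = t" using A.inv_unique[OF L R] c uN by simp
  with L R show thesis using that t(3) c by (simp add: zero_diff)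
qed

text \<open>The place where division closedness enters. The equation \<open>t = 1 + u t\<close> says that \<open>t\<close> is a
  right inverse of \<open>1 - u\<close>, in the form in which the elimination below uses it.\<close>

lemma one_minus_filt_inverse_in:
  assumes D: "division_closed Nov D" and u: "u \<in> D \<inter> filt 1"
  obtains t where "t \<in> D \<inter> filt 0" "t = \<one>\<^bsub>Nov\<^esub> \<oplus>\<^bsub>Nov\<^esub> u \<otimes>\<^bsub>Nov\<^esub> t"
proof -
  interpret A: ring Nov by (rule ring_novikov)
  have sD: "subring D Nov" using D by (simp add: division_closed_def)
  have uN: "u \<in> carrier Nov" using u filt_subset by (auto simp: Nov_carrier)
  obtain t where t: "t \<in> filt 0" "(\<one>\<^bsub>Nov\<^esub> \<ominus>\<^bsub>Nov\<^esub> u) \<otimes>\<^bsub>Nov\<^esub> t = \<one>\<^bsub>Nov\<^esub>"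
    "t \<otimes>\<^bsub>Nov\<^esub> (\<one>\<^bsub>Nov\<^esub> \<ominus>\<^bsub>Nov\<^esub> u) = \<one>\<^bsub>Nov\<^esub>"
    using one_minus_filt_unit u by blast
  have tN: "t \<in> carrier Nov" using t filt_subset by (auto simp: Nov_carrier)
  have "\<one>\<^bsub>Nov\<^esub> \<ominus>\<^bsub>Nov\<^esub> u \<in> D"
    using u subringE(3,5,7)[OF sD] by (simp add: a_minus_def)
  moreover have "\<one>\<^bsub>Nov\<^esub> \<ominus>\<^bsub>Nov\<^esub> u \<in> Units Nov"
    using t tN uN unfolding Units_def by blast
  ultimately have "\<one>\<^bsub>Nov\<^esub> \<ominus>\<^bsub>Nov\<^esub> u \<in> Units (Nov\<lparr>carrier := D\<rparr>)"
    using D unfolding division_closed_def by blast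
  then obtain y where y: "y \<in> D" "y \<otimes>\<^bsub>Nov\<^esub> (\<one>\<^bsub>Nov\<^esub> \<ominus>\<^bsub>Nov\<^esub> u) = \<one>\<^bsub>Nov\<^esub>"
    unfolding Units_def by auto
  have yN: "y \<in> carrier Nov" using y(1) subringE(1)[OF sD] by blast
  have "y = t" using A.inv_unique[OF y(2) t(2)] yN tN uN by simp
  have "\<one>\<^bsub>Nov\<^esub> \<oplus>\<^bsub>Nov\<^esub> u \<otimes>\<^bsub>Nov\<^esub> t = (\<one>\<^bsub>Nov\<^esub> \<ominus>\<^bsub>Nov\<^esub> u) \<otimes>\<^bsub>Nov\<^esub> t \<oplus>\<^bsub>Nov\<^esub> u \<otimes>\<^bsub>Nov\<^esub> t" by (simp add: t(2))
  also have "\<dots> = t" using uN tN by algebra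
  finally show thesis using that[of t] y(1) t(1) \<open>y = t\<close> by auto
qed

end

section \<open>Linear systems over the division closure\<close>

lemma (in abelian_group) add_minus_cancel_left:
  "x \<in> carrier G \<Longrightarrow> y \<in> carrier G \<Longrightarrow> (x \<oplus> y) \<ominus> x = y"
  by (simp add: a_minus_def a_comm[of x y] a_assoc r_neg)

lemma (in abelian_group) finsum_in_subset:
  assumes H: "H \<subseteq> carrier G" "\<zero> \<in> H" "\<And>x y. x \<in> H \<Longrightarrow> y \<in> H \<Longrightarrow> x \<oplus> y \<in> H"
    and f: "\<And>i. i \<in> I \<Longrightarrow> f i \<in> H"
  shows "(\<Oplus>i\<in>I. f i) \<in> H"
  using f
proof (induction I rule: infinite_finite_induct)
  case (insert i I)
  then show ?case using H by (subst finsum_insert) (auto simp: Pi_iff)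
qed (simp_all add: H)

text \<open>Gaussian elimination for \<open>x = w + U x\<close> with entries of \<open>U\<close> in a set \<open>K\<close> for which each
  \<open>1 - u\<close> with \<open>u \<in> K\<close> has a right inverse \<open>t\<close>. The \<open>p\<close>-th equation gives
  \<open>x\<^sub>p = t (w\<^sub>p + \<Sum>\<^sub>j U\<^sub>p\<^sub>j x\<^sub>j)\<close>, summed over the remaining indices. Substituting this in the other
  equations leaves a smaller system of the same kind with coefficients
  \<open>U\<^sub>i\<^sub>j + U\<^sub>i\<^sub>p t U\<^sub>p\<^sub>j\<close>, which is why \<open>K\<close> must be closed under \<open>(a, b) \<mapsto> a t b\<close>.\<close>

lemma (in ring) quasi_regular_system_solvable:
  assumes D: "subring D R" and K: "K \<subseteq> D"
    and K_add: "\<And>a b. a \<in> K \<Longrightarrow> b \<in> K \<Longrightarrow> a \<oplus> b \<in> K"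
    and K_inv: "\<And>u. u \<in> K \<Longrightarrow> \<exists>t\<in>D. t = \<one> \<oplus> u \<otimes> t \<and> (\<forall>a\<in>K. \<forall>b\<in>K. a \<otimes> (t \<otimes> b) \<in> K)"
    and I: "finite I"
    and U: "\<And>i j. i \<in> I \<Longrightarrow> j \<in> I \<Longrightarrow> U i j \<in> K"
    and w: "\<And>i. i \<in> I \<Longrightarrow> w i \<in> D"
  shows "\<exists>x. (\<forall>i\<in>I. x i \<in> D) \<and> (\<forall>i\<in>I. x i = w i \<oplus> (\<Oplus>j\<in>I. U i j \<otimes> x j))"
  using I U w
proof (induction I arbitrary: U w rule: finite_induct)
  case empty
  then show ?case by simp
next
  case (insert p I)
  have DR: "D \<subseteq> carrier R" using subringE(1)[OF D] .
  have KR: "K \<subseteq> carrier R" using K DR by blast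
  obtain t where t: "t \<in> D" "t = \<one> \<oplus> U p p \<otimes> t" "\<And>a b. a \<in> K \<Longrightarrow> b \<in> K \<Longrightarrow> a \<otimes> (t \<otimes> b) \<in> K"
    using K_inv[of "U p p"] insert.prems(1)[of p p] by blast
  define U' where "U' i j = U i j \<oplus> U i p \<otimes> (t \<otimes> U p j)" for i j
  define w' where "w' i = w i \<oplus> U i p \<otimes> (t \<otimes> w p)" for i
  have "\<exists>x. (\<forall>i\<in>I. x i \<in> D) \<and> (\<forall>i\<in>I. x i = w' i \<oplus> (\<Oplus>j\<in>I. U' i j \<otimes> x j))"
  proof (rule insert.IH)
    show "U' i j \<in> K" if "i \<in> I" "j \<in> I" for i j
      using that insert.prems(1) t(3) K_add by (simp add: U'_def)
    show "w' i \<in> D" if "i \<in> I" for i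
      using that insert.prems K t(1) subringE(6,7)[OF D] unfolding w'_def by (meson insertCI subsetD)
  qed
  then obtain x where x: "\<And>i. i \<in> I \<Longrightarrow> x i \<in> D"
    "\<And>i. i \<in> I \<Longrightarrow> x i = w' i \<oplus> (\<Oplus>j\<in>I. U' i j \<otimes> x j)" by blast
  define s where "s i = (\<Oplus>j\<in>I. U i j \<otimes> x j)" for i
  define x' where "x' = x(p := t \<otimes> (w p \<oplus> s p))"
  have c: "U i j \<in> carrier R" "w i \<in> carrier R" if "i \<in> insert p I" "j \<in> insert p I" for i j
    using that insert.prems KR DR by blast+
  have ct: "t \<in> carrier R" using t(1) DR by blast
  have cx: "x i \<in> carrier R" if "i \<in> I" for i using that x(1) DR by blast
  have s_D: "s i \<in> D" if "i \<in> insert p I" for i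
    unfolding s_def using that insert.prems(1) insert.hyps(1) x(1) K subringE(6)[OF D]
    subringE(2,7)[OF D] DR
    by (intro finsum_in_subset) blast+
  have cs: "s i \<in> carrier R" if "i \<in> insert p I" for i using that s_D DR by blast
  have xp_D: "t \<otimes> (w p \<oplus> s p) \<in> D"
    using t(1) insert.prems(2) s_D subringE(6,7)[OF D] by simp
  then have xp: "t \<otimes> (w p \<oplus> s p) \<in> carrier R" using DR by blast
  have row: "(\<Oplus>j\<in>insert p I. U i j \<otimes> x' j) = U i p \<otimes> (t \<otimes> (w p \<oplus> s p)) \<oplus> s i"
    if i: "i \<in> insert p I" for i
  proof -
    have "(\<Oplus>j\<in>insert p I. U i j \<otimes> x' j) = U i p \<otimes> x' p \<oplus> (\<Oplus>j\<in>I. U i j \<otimes> x' j)"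
      using insert.hyps i xp cx c by (intro finsum_insert) (auto simp: x'_def)
    also have "(\<Oplus>j\<in>I. U i j \<otimes> x' j) = s i"
      unfolding s_def using insert.hyps i cx c
      by (intro finsum_cong') (auto simp: x'_def)
    finally show ?thesis by (simp add: x'_def)
  qed
  have "x' i = w i \<oplus> (\<Oplus>j\<in>insert p I. U i j \<otimes> x' j)" if "i \<in> insert p I" for i
  proof (cases "i = p")
    case True
    have "x' p = (\<one> \<oplus> U p p \<otimes> t) \<otimes> (w p \<oplus> s p)" using t(2) by (simp add: x'_def)
    also have "\<dots> = w p \<oplus> (U p p \<otimes> (t \<otimes> (w p \<oplus> s p)) \<oplus> s p)"
      using ct c[of p p] cs[of p] by simp algebra
    finally show ?thesis using True row[of p] by simp
  next
    case False
    with that have i: "i \<in> I" by simp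
    have "(\<Oplus>j\<in>I. U' i j \<otimes> x j) = (\<Oplus>j\<in>I. U i j \<otimes> x j \<oplus> (U i p \<otimes> t) \<otimes> (U p j \<otimes> x j))"
      using i c ct cx by (intro finsum_cong') (auto simp: U'_def l_distr m_assoc)
    also have "\<dots> = s i \<oplus> (\<Oplus>j\<in>I. (U i p \<otimes> t) \<otimes> (U p j \<otimes> x j))"
      unfolding s_def using i c ct cx by (intro finsum_addf) auto
    also have "(\<Oplus>j\<in>I. (U i p \<otimes> t) \<otimes> (U p j \<otimes> x j)) = (U i p \<otimes> t) \<otimes> s p"
      unfolding s_def using i c ct cx insert.hyps by (intro finsum_rdistr[symmetric]) auto
    finally have "x i = w i \<oplus> U i p \<otimes> (t \<otimes> w p) \<oplus> (s i \<oplus> (U i p \<otimes> t) \<otimes> s p)"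
      using x(2)[OF i] by (simp add: w'_def)
    also have "\<dots> = w i \<oplus> (U i p \<otimes> (t \<otimes> (w p \<oplus> s p)) \<oplus> s i)"
      using ct c[of i p] c[of p p] cs[of i] cs[of p] i by simp algebra
    finally show ?thesis using row[of i] i False by (simp add: x'_def)
  qed
  moreover have "x' i \<in> D" if "i \<in> insert p I" for i
    using that x(1) xp_D by (auto simp: x'_def)
  ultimately show ?case by blast
qed

text \<open>Elimination with \<open>K\<close> the elements of \<open>D\<close> supported where \<open>\<phi> \<ge> 1\<close>. It applies because the
  inverses of pivots are supported where \<open>\<phi> \<ge> 0\<close>, so that \<open>a t b\<close> is supported even where
  \<open>\<phi> \<ge> 2\<close>.\<close>

lemma (in novikov) division_closed_system_solvable:
  assumes D: "division_closed Nov D" and I: "finite I"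
    and U: "\<And>i j. i \<in> I \<Longrightarrow> j \<in> I \<Longrightarrow> U i j \<in> D \<inter> filt 1"
    and w: "\<And>i. i \<in> I \<Longrightarrow> w i \<in> D"
  obtains x where "\<And>i. i \<in> I \<Longrightarrow> x i \<in> D"
    "\<And>i. i \<in> I \<Longrightarrow> x i = w i \<oplus>\<^bsub>Nov\<^esub> (\<Oplus>\<^bsub>Nov\<^esub>j\<in>I. U i j \<otimes>\<^bsub>Nov\<^esub> x j)"
proof -
  interpret A: ring Nov by (rule ring_novikov)
  interpret F: additive_subgroup "filt 1" Nov by (rule additive_subgroup_filt)
  have sD: "subring D Nov" using D by (simp add: division_closed_def)
  have "\<exists>x. (\<forall>i\<in>I. x i \<in> D) \<and> (\<forall>i\<in>I. x i = w i \<oplus>\<^bsub>Nov\<^esub> (\<Oplus>\<^bsub>Nov\<^esub>j\<in>I. U i j \<otimes>\<^bsub>Nov\<^esub> x j))"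
  proof (rule A.quasi_regular_system_solvable[OF sD _ _ _ I])
    fix u assume "u \<in> D \<inter> filt 1"
    then obtain t where t: "t \<in> D \<inter> filt 0" "t = \<one>\<^bsub>Nov\<^esub> \<oplus>\<^bsub>Nov\<^esub> u \<otimes>\<^bsub>Nov\<^esub> t"
      using one_minus_filt_inverse_in[OF D] by blast
    have "a \<otimes>\<^bsub>Nov\<^esub> (t \<otimes>\<^bsub>Nov\<^esub> b) \<in> D \<inter> filt 1" if ab: "a \<in> D \<inter> filt 1" "b \<in> D \<inter> filt 1" for a b
    proof -
      have "a \<otimes>\<^bsub>Nov\<^esub> (t \<otimes>\<^bsub>Nov\<^esub> b) \<in> filt (1 + (0 + 1))"
        using ab t(1) by (intro filt_mult) auto
      then have "a \<otimes>\<^bsub>Nov\<^esub> (t \<otimes>\<^bsub>Nov\<^esub> b) \<in> filt 1" using filt_antimono[of 1 2] by auto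
      then show ?thesis using ab t(1) subringE(6)[OF sD] by simp
    qed
    then show "\<exists>t\<in>D. t = \<one>\<^bsub>Nov\<^esub> \<oplus>\<^bsub>Nov\<^esub> u \<otimes>\<^bsub>Nov\<^esub> t \<and>
        (\<forall>a\<in>D \<inter> filt 1. \<forall>b\<in>D \<inter> filt 1. a \<otimes>\<^bsub>Nov\<^esub> (t \<otimes>\<^bsub>Nov\<^esub> b) \<in> D \<inter> filt 1)"
      using t by blast
  qed (use U w subringE(7)[OF sD] in auto)
  then show thesis using that by blast
qed

section \<open>Coordinates in based free modules\<close>

text \<open>The product of ideals shares its symbol with the right scalar multiplication.\<close>

no_notation ideal_prod (infixl \<open>\<cdot>\<index>\<close> 80)

lemma additive_finsum:
  assumes M: "abelian_group M" and N: "abelian_group N"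
    and cl: "\<And>m. m \<in> carrier M \<Longrightarrow> f m \<in> carrier N"
    and add: "\<And>m m'. m \<in> carrier M \<Longrightarrow> m' \<in> carrier M \<Longrightarrow> f (m \<oplus>\<^bsub>M\<^esub> m') = f m \<oplus>\<^bsub>N\<^esub> f m'"
    and g: "\<And>s. s \<in> S \<Longrightarrow> g s \<in> carrier M"
  shows "f (\<Oplus>\<^bsub>M\<^esub>s\<in>S. g s) = (\<Oplus>\<^bsub>N\<^esub>s\<in>S. f (g s))"
proof -
  interpret M: abelian_group M by (rule M)
  interpret N: abelian_group N by (rule N)
  have zero: "f \<zero>\<^bsub>M\<^esub> = \<zero>\<^bsub>N\<^esub>"
    using add[of "\<zero>\<^bsub>M\<^esub>" "\<zero>\<^bsub>M\<^esub>"] cl[of "\<zero>\<^bsub>M\<^esub>"] by simp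
  show ?thesis using g
  proof (induction S rule: infinite_finite_induct)
    case (insert s S)
    have "(\<Oplus>\<^bsub>M\<^esub>s\<in>insert s S. g s) = g s \<oplus>\<^bsub>M\<^esub> (\<Oplus>\<^bsub>M\<^esub>s\<in>S. g s)"
      using insert by (intro M.finsum_insert) auto
    moreover have "(\<Oplus>\<^bsub>N\<^esub>s\<in>insert s S. f (g s)) = f (g s) \<oplus>\<^bsub>N\<^esub> (\<Oplus>\<^bsub>N\<^esub>s\<in>S. f (g s))"
      using insert cl by (intro N.finsum_insert) auto
    ultimately show ?case using insert add M.finsum_closed[of g S] by (simp add: Pi_iff)
  qed (simp_all add: zero)
qed

context right_module
begin

lemma rsmult_zero_right: "m \<in> carrier M \<Longrightarrow> m \<cdot>\<^bsub>M\<^esub> \<zero>\<^bsub>A\<^esub> = \<zero>\<^bsub>M\<^esub>"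
  using rsmult_r_distr[of m "\<zero>\<^bsub>A\<^esub>" "\<zero>\<^bsub>A\<^esub>"] rsmult_closed[of m "\<zero>\<^bsub>A\<^esub>"]
  by (metis A.l_zero A.zero_closed M.add.l_cancel_one)

lemma rsmult_finsum_left:
  assumes "\<And>s. s \<in> S \<Longrightarrow> g s \<in> carrier M" "a \<in> carrier A"
  shows "(\<Oplus>\<^bsub>M\<^esub>s\<in>S. g s) \<cdot>\<^bsub>M\<^esub> a = (\<Oplus>\<^bsub>M\<^esub>s\<in>S. g s \<cdot>\<^bsub>M\<^esub> a)"
  using assms rsmult_l_distr
  by (intro additive_finsum[where f = "\<lambda>m. m \<cdot>\<^bsub>M\<^esub> a"] M.abelian_group_axioms) auto

end

locale based_free_module = right_module A M
  for A :: "('a, 'x) ring_scheme" (structure)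
    and M :: "('a, 'm, 'y) right_module_scheme" (structure) +
  fixes I :: "'i set" and b :: "'i \<Rightarrow> 'm"
  assumes based: "based_free A M I b"
begin

abbreviation coord :: "'m \<Rightarrow> 'i \<Rightarrow> 'a" where
  "coord m \<equiv> coordinates A M I b m"

lemma basis_closed: "i \<in> I \<Longrightarrow> b i \<in> carrier M"
  using based by (auto simp: based_free_def)

lemma ex1_coordinates: "m \<in> carrier M \<Longrightarrow> \<exists>!c. is_coordinates A M I b m c"
  using based by (simp add: based_free_def)

lemma is_coordinates_coord: "m \<in> carrier M \<Longrightarrow> is_coordinates A M I b m (coord m)"
  unfolding coordinates_def by (rule theI'[OF ex1_coordinates])

lemma coord_unique: "m \<in> carrier M \<Longrightarrow> is_coordinates A M I b m c \<Longrightarrow> coord m = c"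
  unfolding coordinates_def by (rule the1_equality[OF ex1_coordinates])

lemma coord_closed [simp, intro]: "m \<in> carrier M \<Longrightarrow> i \<in> I \<Longrightarrow> coord m i \<in> carrier A"
  using is_coordinates_coord[of m] by (auto simp: is_coordinates_def)

lemma finite_supp_coord: "m \<in> carrier M \<Longrightarrow> finite (supp A I (coord m))"
  using is_coordinates_coord[of m] by (simp add: is_coordinates_def)

lemma sum_over_supp:
  assumes c: "\<And>i. i \<in> I \<Longrightarrow> c i \<in> carrier A" and S: "finite S" "S \<subseteq> I" "supp A I c \<subseteq> S"
  shows "(\<Oplus>\<^bsub>M\<^esub>i\<in>supp A I c. b i \<cdot>\<^bsub>M\<^esub> c i) = (\<Oplus>\<^bsub>M\<^esub>i\<in>S. b i \<cdot>\<^bsub>M\<^esub> c i)"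
proof (rule M.add.finprod_mono_neutral_cong_left[OF S(1,3)])
  show "b i \<cdot>\<^bsub>M\<^esub> c i = \<zero>\<^bsub>M\<^esub>" if "i \<in> S - supp A I c" for i
  proof -
    have "c i = \<zero>\<^bsub>A\<^esub>" "i \<in> I" using that S(2) by (auto simp: supp_def)
    then show ?thesis using rsmult_zero_right basis_closed by simp
  qed
qed (use c S(2) basis_closed in auto)

lemma coord_expansion:
  assumes m: "m \<in> carrier M" and S: "finite S" "S \<subseteq> I" "supp A I (coord m) \<subseteq> S"
  shows "(\<Oplus>\<^bsub>M\<^esub>i\<in>S. b i \<cdot>\<^bsub>M\<^esub> coord m i) = m"
proof -
  have "m = (\<Oplus>\<^bsub>M\<^esub>i\<in>supp A I (coord m). b i \<cdot>\<^bsub>M\<^esub> coord m i)"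
    using is_coordinates_coord[OF m] by (simp add: is_coordinates_def)
  also have "\<dots> = (\<Oplus>\<^bsub>M\<^esub>i\<in>S. b i \<cdot>\<^bsub>M\<^esub> coord m i)"
    using m S by (intro sum_over_supp) auto
  finally show ?thesis by simp
qed

lemma coord_sum:
  assumes S: "finite S" "S \<subseteq> I" and c: "\<And>i. i \<in> I \<Longrightarrow> c i \<in> carrier A"
    and out: "\<And>i. i \<in> I - S \<Longrightarrow> c i = \<zero>\<^bsub>A\<^esub>" and i: "i \<in> I"
  shows "coord (\<Oplus>\<^bsub>M\<^esub>i\<in>S. b i \<cdot>\<^bsub>M\<^esub> c i) i = c i"
proof -
  define d where "d = restrict c I"
  have d: "d \<in> I \<rightarrow>\<^sub>E carrier A" "supp A I d \<subseteq> S"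
    using c out by (auto simp: d_def supp_def)
  have "(\<Oplus>\<^bsub>M\<^esub>i\<in>supp A I d. b i \<cdot>\<^bsub>M\<^esub> d i) = (\<Oplus>\<^bsub>M\<^esub>i\<in>S. b i \<cdot>\<^bsub>M\<^esub> d i)"
    using d S by (intro sum_over_supp) auto
  also have "\<dots> = (\<Oplus>\<^bsub>M\<^esub>i\<in>S. b i \<cdot>\<^bsub>M\<^esub> c i)"
    using S c basis_closed by (intro M.finsum_cong') (auto simp: d_def subset_eq)
  finally have "is_coordinates A M I b (\<Oplus>\<^bsub>M\<^esub>i\<in>S. b i \<cdot>\<^bsub>M\<^esub> c i) d"
    using d S(1) finite_subset unfolding is_coordinates_def by auto
  moreover have "(\<Oplus>\<^bsub>M\<^esub>i\<in>S. b i \<cdot>\<^bsub>M\<^esub> c i) \<in> carrier M"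
    using S c basis_closed by (intro M.finsum_closed) auto
  ultimately show ?thesis using coord_unique i by (simp add: d_def)
qed

lemma coord_add:
  assumes m: "m \<in> carrier M" and m': "m' \<in> carrier M" and i: "i \<in> I"
  shows "coord (m \<oplus>\<^bsub>M\<^esub> m') i = coord m i \<oplus>\<^bsub>A\<^esub> coord m' i"
proof -
  define S where "S = supp A I (coord m) \<union> supp A I (coord m')"
  have S: "finite S" "S \<subseteq> I" "supp A I (coord m) \<subseteq> S" "supp A I (coord m') \<subseteq> S"
    using finite_supp_coord m m' by (auto simp: S_def supp_def)
  have SI: "j \<in> I" if "j \<in> S" for j using that S(2) by blast
  let ?sum = "\<Oplus>\<^bsub>M\<^esub>j\<in>S. b j \<cdot>\<^bsub>M\<^esub> (coord m j \<oplus>\<^bsub>A\<^esub> coord m' j)"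
  have "m \<oplus>\<^bsub>M\<^esub> m' = (\<Oplus>\<^bsub>M\<^esub>j\<in>S. b j \<cdot>\<^bsub>M\<^esub> coord m j) \<oplus>\<^bsub>M\<^esub> (\<Oplus>\<^bsub>M\<^esub>j\<in>S. b j \<cdot>\<^bsub>M\<^esub> coord m' j)"
    by (simp only: coord_expansion[OF m S(1,2,3)] coord_expansion[OF m' S(1,2,4)])
  also have "\<dots> = (\<Oplus>\<^bsub>M\<^esub>j\<in>S. b j \<cdot>\<^bsub>M\<^esub> coord m j \<oplus>\<^bsub>M\<^esub> b j \<cdot>\<^bsub>M\<^esub> coord m' j)"
    using m m' SI basis_closed by (intro M.finsum_addf[symmetric]) auto
  also have "\<dots> = ?sum"
    using m m' SI basis_closed by (intro M.finsum_cong') (auto simp: rsmult_r_distr)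
  finally have eq: "m \<oplus>\<^bsub>M\<^esub> m' = ?sum" .
  have "coord ?sum i = coord m i \<oplus>\<^bsub>A\<^esub> coord m' i"
  proof (rule coord_sum[OF S(1,2) _ _ i])
    show "coord m j \<oplus>\<^bsub>A\<^esub> coord m' j = \<zero>\<^bsub>A\<^esub>" if "j \<in> I - S" for j
      using that by (simp add: S_def supp_def)
  qed (use m m' in auto)
  then show ?thesis by (simp only: eq)
qed

lemma coord_rsmult:
  assumes m: "m \<in> carrier M" and a: "a \<in> carrier A" and i: "i \<in> I"
  shows "coord (m \<cdot>\<^bsub>M\<^esub> a) i = coord m i \<otimes>\<^bsub>A\<^esub> a"
proof -
  define S where "S = supp A I (coord m)"
  have S: "finite S" "S \<subseteq> I" "supp A I (coord m) \<subseteq> S"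
    using finite_supp_coord m by (auto simp: S_def supp_def)
  have SI: "j \<in> I" if "j \<in> S" for j using that S(2) by blast
  let ?sum = "\<Oplus>\<^bsub>M\<^esub>j\<in>S. b j \<cdot>\<^bsub>M\<^esub> (coord m j \<otimes>\<^bsub>A\<^esub> a)"
  have "m \<cdot>\<^bsub>M\<^esub> a = (\<Oplus>\<^bsub>M\<^esub>j\<in>S. b j \<cdot>\<^bsub>M\<^esub> coord m j) \<cdot>\<^bsub>M\<^esub> a"
    by (simp only: coord_expansion[OF m S])
  also have "\<dots> = (\<Oplus>\<^bsub>M\<^esub>j\<in>S. b j \<cdot>\<^bsub>M\<^esub> coord m j \<cdot>\<^bsub>M\<^esub> a)"
    using m a SI basis_closed by (intro rsmult_finsum_left) auto
  also have "\<dots> = ?sum"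
    using m a SI basis_closed by (intro M.finsum_cong') (auto simp: rsmult_assoc)
  finally have eq: "m \<cdot>\<^bsub>M\<^esub> a = ?sum" .
  have "coord ?sum i = coord m i \<otimes>\<^bsub>A\<^esub> a"
  proof (rule coord_sum[OF S(1,2) _ _ i])
    show "coord m j \<otimes>\<^bsub>A\<^esub> a = \<zero>\<^bsub>A\<^esub>" if "j \<in> I - S" for j
      using that a by (simp add: S_def supp_def)
  qed (use m a in auto)
  then show ?thesis by (simp only: eq)
qed

lemma coord_eqI:
  assumes m: "m \<in> carrier M" and m': "m' \<in> carrier M"
    and eq: "\<And>i. i \<in> I \<Longrightarrow> coord m i = coord m' i"
  shows "m = m'"
proof -
  define S where "S = supp A I (coord m) \<union> supp A I (coord m')"
  have S: "finite S" "S \<subseteq> I" "supp A I (coord m) \<subseteq> S" "supp A I (coord m') \<subseteq> S"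
    using finite_supp_coord m m' by (auto simp: S_def supp_def)
  have SI: "j \<in> I" if "j \<in> S" for j using that S(2) by blast
  have "(\<Oplus>\<^bsub>M\<^esub>j\<in>S. b j \<cdot>\<^bsub>M\<^esub> coord m j) = (\<Oplus>\<^bsub>M\<^esub>j\<in>S. b j \<cdot>\<^bsub>M\<^esub> coord m' j)"
    using SI m' eq basis_closed by (intro M.finsum_cong') auto
  then show ?thesis
    by (simp only: coord_expansion[OF m S(1,2,3)] coord_expansion[OF m' S(1,2,4)])
qed

lemma coord_basis:
  assumes i: "i \<in> I" and j: "j \<in> I"
  shows "coord (b i) j = (if j = i then \<one>\<^bsub>A\<^esub> else \<zero>\<^bsub>A\<^esub>)"
proof -
  have "(\<Oplus>\<^bsub>M\<^esub>j\<in>{i}. b j \<cdot>\<^bsub>M\<^esub> (if j = i then \<one>\<^bsub>A\<^esub> else \<zero>\<^bsub>A\<^esub>)) = b i"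
    using i basis_closed by simp
  moreover have "coord (\<Oplus>\<^bsub>M\<^esub>j\<in>{i}. b j \<cdot>\<^bsub>M\<^esub> (if j = i then \<one>\<^bsub>A\<^esub> else \<zero>\<^bsub>A\<^esub>)) j
      = (if j = i then \<one>\<^bsub>A\<^esub> else \<zero>\<^bsub>A\<^esub>)"
    using i j by (intro coord_sum) auto
  ultimately show ?thesis by simp
qed

lemma coord_finsum:
  assumes "\<And>s. s \<in> S \<Longrightarrow> g s \<in> carrier M" and "i \<in> I"
  shows "coord (\<Oplus>\<^bsub>M\<^esub>s\<in>S. g s) i = (\<Oplus>\<^bsub>A\<^esub>s\<in>S. coord (g s) i)"
  using assms coord_add
  by (intro additive_finsum[where f = "\<lambda>m. coord m i"] M.abelian_group_axioms A.abelian_group_axioms) auto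

text \<open>The coordinates of finitely many generators involve finitely many indices only. At any
  other index all coordinates vanish, contradicting \<open>\<one> \<noteq> \<zero>\<close> for the basis element there.
  Over the zero ring every family is a basis of the zero module, so the assumption matters.\<close>

lemma finite_basis:
  assumes fg: "finitely_generated_module A M" and one: "\<one>\<^bsub>A\<^esub> \<noteq> \<zero>\<^bsub>A\<^esub>"
  shows "finite I"
proof -
  obtain S where S: "finite S" "S \<subseteq> carrier M"
    "\<And>m. m \<in> carrier M \<Longrightarrow> \<exists>c\<in>S \<rightarrow> carrier A. m = (\<Oplus>\<^bsub>M\<^esub>s\<in>S. s \<cdot>\<^bsub>M\<^esub> c s)"
    using fg unfolding finitely_generated_module_def by auto
  have "i \<in> (\<Union>s\<in>S. supp A I (coord s))" if i: "i \<in> I" for i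
  proof (rule ccontr)
    assume notin: "i \<notin> (\<Union>s\<in>S. supp A I (coord s))"
    obtain c where c: "c \<in> S \<rightarrow> carrier A" "b i = (\<Oplus>\<^bsub>M\<^esub>s\<in>S. s \<cdot>\<^bsub>M\<^esub> c s)"
      using S(3)[OF basis_closed[OF i]] by auto
    have "\<one>\<^bsub>A\<^esub> = coord (\<Oplus>\<^bsub>M\<^esub>s\<in>S. s \<cdot>\<^bsub>M\<^esub> c s) i"
      using coord_basis[OF i i] c(2) by simp
    also have "\<dots> = (\<Oplus>\<^bsub>A\<^esub>s\<in>S. coord (s \<cdot>\<^bsub>M\<^esub> c s) i)"
      using S(2) c(1) i by (intro coord_finsum) auto
    also have "\<dots> = (\<Oplus>\<^bsub>A\<^esub>s\<in>S. \<zero>\<^bsub>A\<^esub>)"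
    proof (rule A.finsum_cong')
      show "coord (s \<cdot>\<^bsub>M\<^esub> c s) i = \<zero>\<^bsub>A\<^esub>" if s: "s \<in> S" for s
      proof -
        have "coord s i = \<zero>\<^bsub>A\<^esub>" using notin s i by (auto simp: supp_def)
        moreover have "s \<in> carrier M" "c s \<in> carrier A" using S(2) c(1) s by auto
        ultimately show ?thesis using coord_rsmult i by simp
      qed
    qed auto
    also have "\<dots> = \<zero>\<^bsub>A\<^esub>" by simp
    finally show False using one by simp
  qed
  then have "I \<subseteq> (\<Union>s\<in>S. supp A I (coord s))" by (rule subsetI)
  moreover have "finite (\<Union>s\<in>S. supp A I (coord s))"
    using S(1,2) finite_supp_coord by (intro finite_UN_I) auto
  ultimately show ?thesis by (rule finite_subset)
qed

text \<open>For a subring \<open>D\<close>, this is the \<open>D\<close>-submodule generated by the basis. A homomorphism is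
  defined over \<open>D\<close> when it maps basis elements into this set.\<close>

definition basis_span :: "'a set \<Rightarrow> 'm set" where
  "basis_span D = {m \<in> carrier M. \<forall>i\<in>I. coord m i \<in> D}"

lemma basis_span_closed: "m \<in> basis_span D \<Longrightarrow> m \<in> carrier M"
  by (simp add: basis_span_def)

lemma basis_in_basis_span: "subring D A \<Longrightarrow> i \<in> I \<Longrightarrow> b i \<in> basis_span D"
  using subringE(2,3) basis_closed by (fastforce simp: basis_span_def coord_basis)

lemma rsmult_in_basis_span:
  "subring D A \<Longrightarrow> m \<in> basis_span D \<Longrightarrow> d \<in> D \<Longrightarrow> m \<cdot>\<^bsub>M\<^esub> d \<in> basis_span D"
  using subringE(1,6) by (fastforce simp: basis_span_def coord_rsmult)

lemma minus_in_basis_span: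
  assumes D: "subring D A" and m: "m \<in> basis_span D" "m' \<in> basis_span D"
  shows "m \<ominus>\<^bsub>M\<^esub> m' \<in> basis_span D"
proof -
  have c: "m \<in> carrier M" "m' \<in> carrier M" using m basis_span_closed by auto
  have "coord (m \<ominus>\<^bsub>M\<^esub> m') i \<in> D" if i: "i \<in> I" for i
  proof -
    have "m = (m \<ominus>\<^bsub>M\<^esub> m') \<oplus>\<^bsub>M\<^esub> m'" using c by (simp add: a_minus_def M.a_assoc M.l_neg)
    then have "coord m i = coord (m \<ominus>\<^bsub>M\<^esub> m') i \<oplus>\<^bsub>A\<^esub> coord m' i"
      using coord_add[of "m \<ominus>\<^bsub>M\<^esub> m'" m' i] c i by simp
    then have "coord (m \<ominus>\<^bsub>M\<^esub> m') i = coord m i \<ominus>\<^bsub>A\<^esub> coord m' i"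
      using c i by (simp add: a_minus_def A.a_assoc A.r_neg)
    then show ?thesis using m i subringE(5,7)[OF D] by (simp add: basis_span_def a_minus_def)
  qed
  then show ?thesis using c by (simp add: basis_span_def)
qed

lemma finsum_in_basis_span:
  assumes D: "subring D A" and g: "\<And>s. s \<in> S \<Longrightarrow> g s \<in> basis_span D"
  shows "(\<Oplus>\<^bsub>M\<^esub>s\<in>S. g s) \<in> basis_span D"
proof -
  have c: "\<And>s. s \<in> S \<Longrightarrow> g s \<in> carrier M" using g basis_span_closed by blast
  have "coord (\<Oplus>\<^bsub>M\<^esub>s\<in>S. g s) i \<in> D" if i: "i \<in> I" for i
    using A.finsum_in_subset[where H = D and f = "\<lambda>s. coord (g s) i" and I = S] subringE(1,2,7)[OF D] g i
    by (simp add: coord_finsum[OF c i] basis_span_def)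
  then show ?thesis using c by (simp add: basis_span_def)
qed

end

lemma right_module_homD:
  assumes "f \<in> right_module_hom A M N"
  shows "m \<in> carrier M \<Longrightarrow> f m \<in> carrier N"
    and "m \<in> carrier M \<Longrightarrow> m' \<in> carrier M \<Longrightarrow> f (m \<oplus>\<^bsub>M\<^esub> m') = f m \<oplus>\<^bsub>N\<^esub> f m'"
    and "m \<in> carrier M \<Longrightarrow> a \<in> carrier A \<Longrightarrow> f (m \<cdot>\<^bsub>M\<^esub> a) = f m \<cdot>\<^bsub>N\<^esub> a"
  using assms by (auto simp: right_module_hom_def)

lemma right_module_hom_comp:
  assumes "f \<in> right_module_hom A M N" "g \<in> right_module_hom A N P"
  shows "(\<lambda>m. g (f m)) \<in> right_module_hom A M P"
  using assms by (auto simp: right_module_hom_def Pi_iff)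

lemma right_module_hom_finsum:
  assumes M: "right_module A M" and N: "right_module A N" and f: "f \<in> right_module_hom A M N"
    and g: "\<And>s. s \<in> S \<Longrightarrow> g s \<in> carrier M"
  shows "f (\<Oplus>\<^bsub>M\<^esub>s\<in>S. g s) = (\<Oplus>\<^bsub>N\<^esub>s\<in>S. f (g s))"
proof -
  interpret M: right_module A M by (rule M)
  interpret N: right_module A N by (rule N)
  show ?thesis
    using right_module_homD[OF f] g
    by (intro additive_finsum M.M.abelian_group_axioms N.M.abelian_group_axioms)
qed

lemma right_module_hom_minus:
  assumes M: "right_module A M" and N: "right_module A N" and f: "f \<in> right_module_hom A M N"
    and m: "m \<in> carrier M" "m' \<in> carrier M"
  shows "f (m \<ominus>\<^bsub>M\<^esub> m') = f m \<ominus>\<^bsub>N\<^esub> f m'"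
proof -
  interpret M: right_module A M by (rule M)
  interpret N: right_module A N by (rule N)
  have "m = (m \<ominus>\<^bsub>M\<^esub> m') \<oplus>\<^bsub>M\<^esub> m'" using m by (simp add: a_minus_def M.M.a_assoc M.M.l_neg)
  then have "f m = f (m \<ominus>\<^bsub>M\<^esub> m') \<oplus>\<^bsub>N\<^esub> f m'"
    using right_module_homD(2)[OF f, of "m \<ominus>\<^bsub>M\<^esub> m'" m'] m by simp
  then show ?thesis
    using right_module_homD(1)[OF f] m by (simp add: a_minus_def N.M.a_assoc N.M.r_neg)
qed

lemma right_module_hom_add:
  assumes N: "right_module A N" and f: "f \<in> right_module_hom A M N" and g: "g \<in> right_module_hom A M N"
  shows "(\<lambda>m. f m \<oplus>\<^bsub>N\<^esub> g m) \<in> right_module_hom A M N"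
proof -
  interpret N: right_module A N by (rule N)
  show ?thesis
    using right_module_homD[OF f] right_module_homD[OF g]
    by (auto simp: right_module_hom_def N.rsmult_l_distr N.M.a_ac)
qed

context based_free_module
begin

lemma hom_expansion:
  assumes N: "right_module A N" and f: "f \<in> right_module_hom A M N" and m: "m \<in> carrier M"
    and S: "finite S" "S \<subseteq> I" "supp A I (coord m) \<subseteq> S"
  shows "f m = (\<Oplus>\<^bsub>N\<^esub>i\<in>S. f (b i) \<cdot>\<^bsub>N\<^esub> coord m i)"
proof -
  interpret N: right_module A N by (rule N)
  have "f m = f (\<Oplus>\<^bsub>M\<^esub>i\<in>S. b i \<cdot>\<^bsub>M\<^esub> coord m i)" using coord_expansion[OF m S] by simp
  also have "\<dots> = (\<Oplus>\<^bsub>N\<^esub>i\<in>S. f (b i \<cdot>\<^bsub>M\<^esub> coord m i))"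
    using S m basis_closed
    by (intro right_module_hom_finsum[OF right_module_axioms N f]) auto
  also have "\<dots> = (\<Oplus>\<^bsub>N\<^esub>i\<in>S. f (b i) \<cdot>\<^bsub>N\<^esub> coord m i)"
    using S m basis_closed right_module_homD[OF f] by (intro N.M.finsum_cong') auto
  finally show ?thesis .
qed

lemma hom_eqI:
  assumes N: "right_module A N" and f: "f \<in> right_module_hom A M N" and g: "g \<in> right_module_hom A M N"
    and eq: "\<And>i. i \<in> I \<Longrightarrow> f (b i) = g (b i)" and m: "m \<in> carrier M"
  shows "f m = g m"
proof -
  interpret N: right_module A N by (rule N)
  define S where "S = supp A I (coord m)"
  have S: "finite S" "S \<subseteq> I" "supp A I (coord m) \<subseteq> S"
    using finite_supp_coord m by (auto simp: S_def supp_def)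
  have "(\<Oplus>\<^bsub>N\<^esub>i\<in>S. f (b i) \<cdot>\<^bsub>N\<^esub> coord m i) = (\<Oplus>\<^bsub>N\<^esub>i\<in>S. g (b i) \<cdot>\<^bsub>N\<^esub> coord m i)"
    using S m eq right_module_homD(1)[OF g] basis_closed by (intro N.M.finsum_cong') (auto simp: subset_eq)
  then show ?thesis using hom_expansion[OF N f m S] hom_expansion[OF N g m S] by simp
qed

lemma ex_linear_extension:
  assumes N: "right_module A N" and fin: "finite I" and y: "\<And>i. i \<in> I \<Longrightarrow> y i \<in> carrier N"
  obtains f where "f \<in> right_module_hom A M N" "\<And>i. i \<in> I \<Longrightarrow> f (b i) = y i"
proof -
  interpret N: right_module A N by (rule N)
  define f where "f m = (\<Oplus>\<^bsub>N\<^esub>i\<in>I. y i \<cdot>\<^bsub>N\<^esub> coord m i)" for m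
  have "f \<in> right_module_hom A M N"
    unfolding right_module_hom_def
  proof (intro CollectI conjI ballI Pi_I)
    show "f m \<in> carrier N" if "m \<in> carrier M" for m
      unfolding f_def using that y by (intro N.M.finsum_closed) auto
  next
    fix m m' assume m: "m \<in> carrier M" "m' \<in> carrier M"
    have "f (m \<oplus>\<^bsub>M\<^esub> m') = (\<Oplus>\<^bsub>N\<^esub>i\<in>I. y i \<cdot>\<^bsub>N\<^esub> coord m i \<oplus>\<^bsub>N\<^esub> y i \<cdot>\<^bsub>N\<^esub> coord m' i)"
      unfolding f_def using m y by (intro N.M.finsum_cong') (auto simp: coord_add N.rsmult_r_distr)
    also have "\<dots> = f m \<oplus>\<^bsub>N\<^esub> f m'"
      unfolding f_def using m y by (intro N.M.finsum_addf) auto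
    finally show "f (m \<oplus>\<^bsub>M\<^esub> m') = f m \<oplus>\<^bsub>N\<^esub> f m'" .
  next
    fix m a assume m: "m \<in> carrier M" "a \<in> carrier A"
    have "f (m \<cdot>\<^bsub>M\<^esub> a) = (\<Oplus>\<^bsub>N\<^esub>i\<in>I. y i \<cdot>\<^bsub>N\<^esub> coord m i \<cdot>\<^bsub>N\<^esub> a)"
      unfolding f_def using m y by (intro N.M.finsum_cong') (auto simp: coord_rsmult N.rsmult_assoc)
    also have "\<dots> = f m \<cdot>\<^bsub>N\<^esub> a"
      unfolding f_def using m y by (intro N.rsmult_finsum_left[symmetric]) auto
    finally show "f (m \<cdot>\<^bsub>M\<^esub> a) = f m \<cdot>\<^bsub>N\<^esub> a" .
  qed
  moreover have "f (b i) = y i" if i: "i \<in> I" for i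
  proof -
    have "f (b i) = (\<Oplus>\<^bsub>N\<^esub>j\<in>I. if i = j then y j else \<zero>\<^bsub>N\<^esub>)"
      unfolding f_def using i y
      by (intro N.M.finsum_cong') (auto simp: coord_basis N.rsmult_zero_right)
    also have "\<dots> = y i" using i fin y by (intro N.M.finsum_singleton) auto
    finally show ?thesis .
  qed
  ultimately show thesis by (rule that)
qed

end

lemma defined_over_hom_basis_span:
  assumes M: "based_free_module A M I b" and N: "based_free_module A N J b'"
    and D: "subring D A" and f: "f \<in> right_module_hom A M N" "defined_over A D I b N J b' f"
    and m: "m \<in> based_free_module.basis_span A M I b D"
  shows "f m \<in> based_free_module.basis_span A N J b' D"
proof -
  interpret M: based_free_module A M I b by (rule M)
  interpret N: based_free_module A N J b' by (rule N)
  have m': "m \<in> carrier M" using m M.basis_span_closed by blast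
  define S where "S = supp A I (M.coord m)"
  have S: "finite S" "S \<subseteq> I" "supp A I (M.coord m) \<subseteq> S"
    using M.finite_supp_coord m' by (auto simp: S_def supp_def)
  have "f (b i) \<in> N.basis_span D" if "i \<in> I" for i
    using that f(2) right_module_homD(1)[OF f(1)] M.basis_closed
    by (auto simp: N.basis_span_def defined_over_def matrix_entry_def)
  then have "f (b i) \<cdot>\<^bsub>N\<^esub> M.coord m i \<in> N.basis_span D" if "i \<in> S" for i
    using that S(2) m by (intro N.rsmult_in_basis_span[OF D]) (auto simp: M.basis_span_def)
  then have "(\<Oplus>\<^bsub>N\<^esub>i\<in>S. f (b i) \<cdot>\<^bsub>N\<^esub> M.coord m i) \<in> N.basis_span D" by (rule N.finsum_in_basis_span[OF D])
  then show ?thesis by (simp only: M.hom_expansion[OF N.right_module_axioms f(1) m' S])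
qed

section \<open>Moving the homotopy into the division closure\<close>

text \<open>The truncation of the homotopy, on one element \<open>z\<close>. Only finitely many coordinates of \<open>z\<close>
  are nonzero, and \<open>J\<close> is finite, so finitely many entries of the matrix of \<open>f\<close> matter. If
  those in column \<open>l\<close> are supported where \<open>\<phi> \<ge> s\<^sub>l\<close>, it suffices to approximate the
  coordinate of \<open>z\<close> at \<open>l\<close> up to terms supported where \<open>\<phi> \<ge> 1 - s\<^sub>l\<close>.\<close>

lemma (in novikov) approx_in_basis_span:
  assumes M: "based_free_module Nov M I b" and N: "based_free_module Nov N' J b'"
    and J: "finite J" and f: "f \<in> right_module_hom Nov M N'"
    and D: "subring D Nov" "group_ring R G \<subseteq> D"
    and z: "z \<in> carrier M"
  obtains y where "y \<in> based_free_module.basis_span Nov M I b D"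
    "\<And>k. k \<in> J \<Longrightarrow> coordinates Nov N' J b' (f (z \<ominus>\<^bsub>M\<^esub> y)) k \<in> filt 1"
proof -
  interpret A: ring Nov by (rule ring_novikov)
  interpret F: additive_subgroup "filt 1" Nov by (rule additive_subgroup_filt)
  interpret M: based_free_module Nov M I b by (rule M)
  interpret N': based_free_module Nov N' J b' by (rule N)
  note fD = right_module_homD[OF f]
  define S where "S = supp Nov I (M.coord z)"
  have S: "finite S" "S \<subseteq> I" "supp Nov I (M.coord z) \<subseteq> S"
    using M.finite_supp_coord z by (auto simp: S_def supp_def)
  have SI: "l \<in> I" if "l \<in> S" for l using that S(2) by blast
  have "\<exists>s. \<forall>k\<in>J. N'.coord (f (b l)) k \<in> filt s" if l: "l \<in> S" for l
  proof -
    have "\<exists>s. N'.coord (f (b l)) k \<in> filt s" if k: "k \<in> J" for k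
    proof -
      have "N'.coord (f (b l)) k \<in> carrier Nov" using fD(1) M.basis_closed SI l k by auto
      then show ?thesis using ex_filt unfolding Nov_carrier by metis
    qed
    then obtain s where s: "\<And>k. k \<in> J \<Longrightarrow> N'.coord (f (b l)) k \<in> filt (s k)" by metis
    have "N'.coord (f (b l)) k \<in> filt (Min (s ` J))" if k: "k \<in> J" for k
    proof -
      have "Min (s ` J) \<le> s k" using J k by (intro Min_le) auto
      then show ?thesis using s[OF k] filt_antimono by blast
    qed
    then show ?thesis by blast
  qed
  then obtain s where s: "\<And>l k. l \<in> S \<Longrightarrow> k \<in> J \<Longrightarrow> N'.coord (f (b l)) k \<in> filt (s l)" by metis
  have "\<exists>h. h \<in> group_ring R G \<and> M.coord z l \<ominus>\<^bsub>Nov\<^esub> h \<in> filt (1 - s l)" if l: "l \<in> S" for l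
  proof -
    have "M.coord z l \<in> N" using z SI[OF l] by (simp add: Nov_carrier[symmetric])
    then show ?thesis using group_ring_approx by metis
  qed
  then obtain h where h: "\<And>l. l \<in> S \<Longrightarrow> h l \<in> group_ring R G"
    "\<And>l. l \<in> S \<Longrightarrow> M.coord z l \<ominus>\<^bsub>Nov\<^esub> h l \<in> filt (1 - s l)" by metis
  define e where "e l = M.coord z l \<ominus>\<^bsub>Nov\<^esub> h l" for l
  have hD: "h l \<in> D" if "l \<in> S" for l using h(1)[OF that] D(2) by blast
  have hc: "h l \<in> carrier Nov" if "l \<in> S" for l using hD[OF that] subringE(1)[OF D(1)] by blast
  have ec: "e l \<in> carrier Nov" if "l \<in> S" for l using hc[OF that] z SI[OF that] by (simp add: e_def)
  define y where "y = (\<Oplus>\<^bsub>M\<^esub>l\<in>S. b l \<cdot>\<^bsub>M\<^esub> h l)"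
  define r where "r = (\<Oplus>\<^bsub>M\<^esub>l\<in>S. b l \<cdot>\<^bsub>M\<^esub> e l)"
  have y: "y \<in> M.basis_span D"
    unfolding y_def using hD SI M.basis_in_basis_span[OF D(1)]
    by (intro M.finsum_in_basis_span[OF D(1)] M.rsmult_in_basis_span[OF D(1)]) auto
  have yc: "y \<in> carrier M" using y by (rule M.basis_span_closed)
  have rc: "r \<in> carrier M"
    unfolding r_def using ec SI M.basis_closed by (intro M.M.finsum_closed) auto
  have "z = (\<Oplus>\<^bsub>M\<^esub>l\<in>S. b l \<cdot>\<^bsub>M\<^esub> M.coord z l)" by (simp only: M.coord_expansion[OF z S])
  also have "\<dots> = (\<Oplus>\<^bsub>M\<^esub>l\<in>S. b l \<cdot>\<^bsub>M\<^esub> e l \<oplus>\<^bsub>M\<^esub> b l \<cdot>\<^bsub>M\<^esub> h l)"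
  proof (rule M.M.finsum_cong')
    show "b l \<cdot>\<^bsub>M\<^esub> M.coord z l = b l \<cdot>\<^bsub>M\<^esub> e l \<oplus>\<^bsub>M\<^esub> b l \<cdot>\<^bsub>M\<^esub> h l" if l: "l \<in> S" for l
    proof -
      have "M.coord z l = e l \<oplus>\<^bsub>Nov\<^esub> h l"
        using hc[OF l] z SI[OF l] by (simp add: e_def a_minus_def A.a_assoc A.l_neg)
      then show ?thesis using ec[OF l] hc[OF l] M.basis_closed[OF SI[OF l]] by (simp add: M.rsmult_r_distr)
    qed
  qed (use ec hc SI M.basis_closed in auto)
  also have "\<dots> = r \<oplus>\<^bsub>M\<^esub> y"
    unfolding r_def y_def using ec hc SI M.basis_closed by (intro M.M.finsum_addf) auto
  finally have "z \<ominus>\<^bsub>M\<^esub> y = r" using rc yc by (simp add: a_minus_def M.M.a_assoc M.M.r_neg)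
  moreover have "N'.coord (f r) k \<in> filt 1" if k: "k \<in> J" for k
  proof -
    have fb: "f (b l) \<in> carrier N'" if "l \<in> S" for l using fD(1) M.basis_closed SI that by simp
    have "f r = (\<Oplus>\<^bsub>N'\<^esub>l\<in>S. f (b l \<cdot>\<^bsub>M\<^esub> e l))"
      unfolding r_def using ec SI M.basis_closed
      by (intro right_module_hom_finsum[OF M.right_module_axioms N'.right_module_axioms f]) auto
    also have "\<dots> = (\<Oplus>\<^bsub>N'\<^esub>l\<in>S. f (b l) \<cdot>\<^bsub>N'\<^esub> e l)"
      using ec SI M.basis_closed fD fb by (intro N'.M.finsum_cong') auto
    finally have "N'.coord (f r) k = (\<Oplus>\<^bsub>Nov\<^esub>l\<in>S. N'.coord (f (b l) \<cdot>\<^bsub>N'\<^esub> e l) k)"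
      using ec fb k by (simp add: N'.coord_finsum)
    moreover have "N'.coord (f (b l) \<cdot>\<^bsub>N'\<^esub> e l) k \<in> filt 1" if l: "l \<in> S" for l
      using filt_mult[OF s[OF l k] h(2)[OF l]] ec[OF l] fb[OF l] k
      by (simp add: N'.coord_rsmult e_def)
    ultimately show ?thesis
      using F.a_subset A.finsum_in_subset[where H = "filt 1" and f = "\<lambda>l. N'.coord (f (b l) \<cdot>\<^bsub>N'\<^esub> e l) k" and I = S] by simp
  qed
  ultimately show thesis using that[OF y] by simp
qed

text \<open>The value at \<open>b\<^sub>i\<close> of the new homotopy. With \<open>x\<close> the \<open>i\<close>-th column of \<open>(id - U)\<^sup>-\<^sup>1\<close>, the
  element \<open>v = \<Sum>\<^sub>j b\<^sub>j x\<^sub>j\<close> satisfies \<open>v - U v = b\<^sub>i\<close>, and the wanted element is the truncated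
  homotopy applied to \<open>v\<close>, here called \<open>z\<close>. Thus \<open>e v + d z = b\<^sub>i\<close>, and applying the
  idempotent \<open>e\<close>, which kills the image of \<open>d\<close>, replaces \<open>e v\<close> by \<open>e b\<^sub>i\<close>.\<close>

lemma (in novikov) ex_homotopy_value_in_basis_span:
  assumes C: "based_free_module Nov C I b" and S: "based_free_module Nov S J b'"
    and I: "finite I" and D: "division_closed Nov D" "group_ring R G \<subseteq> D"
    and d: "d \<in> right_module_hom Nov S C" "defined_over Nov D J b' C I b d"
    and h: "h \<in> right_module_hom Nov C S"
    and e: "e \<in> right_module_hom Nov C C" "defined_over Nov D I b C I b e"
    and ed: "\<And>x. x \<in> carrier S \<Longrightarrow> e (d x) = \<zero>\<^bsub>C\<^esub>"
    and homotopy: "\<And>x. x \<in> carrier C \<Longrightarrow> e x \<oplus>\<^bsub>C\<^esub> d (h x) = x"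
    and i: "i \<in> I"
  obtains y where "y \<in> based_free_module.basis_span Nov S J b' D" "e (b i) \<oplus>\<^bsub>C\<^esub> d y = b i"
proof -
  interpret A: ring Nov by (rule ring_novikov)
  interpret C: based_free_module Nov C I b by (rule C)
  interpret S: based_free_module Nov S J b' by (rule S)
  have sD: "subring D Nov" using D by (simp add: division_closed_def)
  note dD = right_module_homD[OF d(1)] and hD = right_module_homD[OF h] and eD = right_module_homD[OF e(1)]
  note bc = C.basis_closed
  have "\<exists>y. y \<in> S.basis_span D \<and> (\<forall>k\<in>I. C.coord (d (h (b j) \<ominus>\<^bsub>S\<^esub> y)) k \<in> filt 1)" if j: "j \<in> I" for j
    using approx_in_basis_span[OF S C I d(1) sD D(2) hD(1)[OF bc[OF j]]] by metis
  then obtain y where y: "\<And>j. j \<in> I \<Longrightarrow> y j \<in> S.basis_span D"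
    "\<And>j k. j \<in> I \<Longrightarrow> k \<in> I \<Longrightarrow> C.coord (d (h (b j) \<ominus>\<^bsub>S\<^esub> y j)) k \<in> filt 1" by metis
  have yc: "y j \<in> carrier S" if "j \<in> I" for j using y(1)[OF that] by (rule S.basis_span_closed)
  \<comment> \<open>The column of \<open>U\<close> at \<open>j\<close>: the error that truncation causes in the homotopy identity.\<close>
  define u where "u j = d (h (b j) \<ominus>\<^bsub>S\<^esub> y j)" for j
  have uc: "u j \<in> carrier C" if "j \<in> I" for j
    using that dD(1) hD(1) yc bc by (simp add: u_def)
  have u_sum: "e (b j) \<oplus>\<^bsub>C\<^esub> d (y j) \<oplus>\<^bsub>C\<^esub> u j = b j" if j: "j \<in> I" for j
  proof -
    have c: "h (b j) \<in> carrier S" "d (h (b j)) \<in> carrier C" "d (y j) \<in> carrier C" "e (b j) \<in> carrier C"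
      using j dD(1) hD(1) eD(1) yc bc by simp_all
    have "u j = d (h (b j)) \<ominus>\<^bsub>C\<^esub> d (y j)"
      unfolding u_def
      by (rule right_module_hom_minus[OF S.right_module_axioms C.right_module_axioms d(1) c(1) yc[OF j]])
    then have "d (y j) \<oplus>\<^bsub>C\<^esub> u j = d (h (b j))"
      using c by (simp add: a_minus_def C.M.a_comm[of "d (y j)"] C.M.a_assoc C.M.l_neg)
    then show ?thesis using homotopy[OF bc[OF j]] c uc[OF j] by (simp add: C.M.a_assoc)
  qed
  \<comment> \<open>The definition of \<open>u\<close> involves \<open>h\<close>, whose entries need not lie in \<open>D\<close>; the homotopy
    identity expresses \<open>u\<close> by data over \<open>D\<close>.\<close>
  have uD: "u j \<in> C.basis_span D" if j: "j \<in> I" for j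
  proof -
    have l: "e (b j) \<in> C.basis_span D" "d (y j) \<in> C.basis_span D" "b j \<in> C.basis_span D"
      using defined_over_hom_basis_span[OF C C sD e] defined_over_hom_basis_span[OF S C sD d]
        y(1)[OF j] C.basis_in_basis_span[OF sD j] by auto
    then have c: "e (b j) \<in> carrier C" "d (y j) \<in> carrier C" using C.basis_span_closed by auto
    have "b j \<ominus>\<^bsub>C\<^esub> e (b j) = d (y j) \<oplus>\<^bsub>C\<^esub> u j"
      using C.M.add_minus_cancel_left[of "e (b j)" "d (y j) \<oplus>\<^bsub>C\<^esub> u j"] u_sum[OF j] c uc[OF j]
      by (simp add: C.M.a_assoc)
    then have "u j = (b j \<ominus>\<^bsub>C\<^esub> e (b j)) \<ominus>\<^bsub>C\<^esub> d (y j)"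
      using C.M.add_minus_cancel_left[of "d (y j)" "u j"] c uc[OF j] by simp
    then show ?thesis using l C.minus_in_basis_span[OF sD] by simp
  qed
  obtain x where x: "\<And>k. k \<in> I \<Longrightarrow> x k \<in> D"
    "\<And>k. k \<in> I \<Longrightarrow> x k = C.coord (b i) k \<oplus>\<^bsub>Nov\<^esub> (\<Oplus>\<^bsub>Nov\<^esub>j\<in>I. C.coord (u j) k \<otimes>\<^bsub>Nov\<^esub> x j)"
  proof (rule division_closed_system_solvable[OF D(1) I, where U = "\<lambda>k j. C.coord (u j) k" and w = "C.coord (b i)"])
    show "C.coord (u j) k \<in> D \<inter> filt 1" if "k \<in> I" "j \<in> I" for k j
      using y(2)[OF that(2,1)] uD[OF that(2)] that(1) by (simp add: u_def C.basis_span_def)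
    show "C.coord (b i) k \<in> D" if "k \<in> I" for k
      using C.basis_in_basis_span[OF sD i] that by (simp add: C.basis_span_def)
  qed blast
  have xc: "x k \<in> carrier Nov" if "k \<in> I" for k using x(1)[OF that] subringE(1)[OF sD] by blast
  define v where "v = (\<Oplus>\<^bsub>C\<^esub>j\<in>I. b j \<cdot>\<^bsub>C\<^esub> x j)"
  define r where "r = (\<Oplus>\<^bsub>C\<^esub>j\<in>I. u j \<cdot>\<^bsub>C\<^esub> x j)"
  define z where "z = (\<Oplus>\<^bsub>S\<^esub>j\<in>I. y j \<cdot>\<^bsub>S\<^esub> x j)"
  have vc: "v \<in> carrier C" and rc: "r \<in> carrier C" and zc: "z \<in> carrier S"
    unfolding v_def r_def z_def using xc uc yc bc
    by (auto intro!: C.M.finsum_closed S.M.finsum_closed)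
  have zD: "z \<in> S.basis_span D"
    unfolding z_def using y(1) x(1) by (intro S.finsum_in_basis_span[OF sD] S.rsmult_in_basis_span[OF sD])
  have v_eq: "v = b i \<oplus>\<^bsub>C\<^esub> r"
  proof (rule C.coord_eqI)
    fix k assume k: "k \<in> I"
    have "C.coord v k = x k"
      unfolding v_def using I xc k by (intro C.coord_sum) auto
    moreover have "C.coord r k = (\<Oplus>\<^bsub>Nov\<^esub>j\<in>I. C.coord (u j) k \<otimes>\<^bsub>Nov\<^esub> x j)"
    proof -
      have "C.coord r k = (\<Oplus>\<^bsub>Nov\<^esub>j\<in>I. C.coord (u j \<cdot>\<^bsub>C\<^esub> x j) k)"
        unfolding r_def using uc xc k by (intro C.coord_finsum) auto
      also have "\<dots> = (\<Oplus>\<^bsub>Nov\<^esub>j\<in>I. C.coord (u j) k \<otimes>\<^bsub>Nov\<^esub> x j)"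
        using uc xc k by (intro A.finsum_cong') (auto simp: C.coord_rsmult)
      finally show ?thesis .
    qed
    ultimately show "C.coord v k = C.coord (b i \<oplus>\<^bsub>C\<^esub> r) k"
      using x(2)[OF k] C.coord_add[OF bc[OF i] rc k] by simp
  qed (use vc rc bc i in auto)
  have ev: "e v = (\<Oplus>\<^bsub>C\<^esub>j\<in>I. e (b j) \<cdot>\<^bsub>C\<^esub> x j)"
  proof -
    have "e v = (\<Oplus>\<^bsub>C\<^esub>j\<in>I. e (b j \<cdot>\<^bsub>C\<^esub> x j))"
      unfolding v_def using xc bc
      by (intro right_module_hom_finsum[OF C.right_module_axioms C.right_module_axioms e(1)]) auto
    also have "\<dots> = (\<Oplus>\<^bsub>C\<^esub>j\<in>I. e (b j) \<cdot>\<^bsub>C\<^esub> x j)"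
      using xc bc eD by (intro C.M.finsum_cong') auto
    finally show ?thesis .
  qed
  have dz: "d z = (\<Oplus>\<^bsub>C\<^esub>j\<in>I. d (y j) \<cdot>\<^bsub>C\<^esub> x j)"
  proof -
    have "d z = (\<Oplus>\<^bsub>C\<^esub>j\<in>I. d (y j \<cdot>\<^bsub>S\<^esub> x j))"
      unfolding z_def using xc yc
      by (intro right_module_hom_finsum[OF S.right_module_axioms C.right_module_axioms d(1)]) auto
    also have "\<dots> = (\<Oplus>\<^bsub>C\<^esub>j\<in>I. d (y j) \<cdot>\<^bsub>C\<^esub> x j)"
      using xc yc dD by (intro C.M.finsum_cong') auto
    finally show ?thesis .
  qed
  have evc: "e v \<in> carrier C" and dzc: "d z \<in> carrier C" using eD(1) dD(1) vc zc by auto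
  have "v = (\<Oplus>\<^bsub>C\<^esub>j\<in>I. e (b j) \<cdot>\<^bsub>C\<^esub> x j \<oplus>\<^bsub>C\<^esub> d (y j) \<cdot>\<^bsub>C\<^esub> x j \<oplus>\<^bsub>C\<^esub> u j \<cdot>\<^bsub>C\<^esub> x j)"
    unfolding v_def
  proof (rule C.M.finsum_cong')
    show "b j \<cdot>\<^bsub>C\<^esub> x j = e (b j) \<cdot>\<^bsub>C\<^esub> x j \<oplus>\<^bsub>C\<^esub> d (y j) \<cdot>\<^bsub>C\<^esub> x j \<oplus>\<^bsub>C\<^esub> u j \<cdot>\<^bsub>C\<^esub> x j" if j: "j \<in> I" for j
    proof -
      have "b j \<cdot>\<^bsub>C\<^esub> x j = (e (b j) \<oplus>\<^bsub>C\<^esub> d (y j) \<oplus>\<^bsub>C\<^esub> u j) \<cdot>\<^bsub>C\<^esub> x j" by (simp only: u_sum[OF j])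
      then show ?thesis
        using xc[OF j] uc[OF j] eD(1)[OF bc[OF j]] dD(1)[OF yc[OF j]] by (simp add: C.rsmult_l_distr)
    qed
  qed (use xc uc yc bc eD(1) dD(1) in auto)
  also have "\<dots> = (\<Oplus>\<^bsub>C\<^esub>j\<in>I. e (b j) \<cdot>\<^bsub>C\<^esub> x j \<oplus>\<^bsub>C\<^esub> d (y j) \<cdot>\<^bsub>C\<^esub> x j) \<oplus>\<^bsub>C\<^esub> r"
    unfolding r_def using xc uc yc bc eD(1) dD(1) by (intro C.M.finsum_addf) auto
  also have "(\<Oplus>\<^bsub>C\<^esub>j\<in>I. e (b j) \<cdot>\<^bsub>C\<^esub> x j \<oplus>\<^bsub>C\<^esub> d (y j) \<cdot>\<^bsub>C\<^esub> x j) = e v \<oplus>\<^bsub>C\<^esub> d z"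
    unfolding ev dz using xc yc bc eD(1) dD(1) by (intro C.M.finsum_addf) auto
  finally have "b i \<oplus>\<^bsub>C\<^esub> r = (e v \<oplus>\<^bsub>C\<^esub> d z) \<oplus>\<^bsub>C\<^esub> r" using v_eq by simp
  then have split_b: "b i = e v \<oplus>\<^bsub>C\<^esub> d z"
    using evc dzc rc bc[OF i] C.M.add.r_cancel[of r "b i" "e v \<oplus>\<^bsub>C\<^esub> d z"] by simp
  have idem: "e (e m) = e m" if m: "m \<in> carrier C" for m
  proof -
    have "e m = e (e m \<oplus>\<^bsub>C\<^esub> d (h m))" by (simp only: homotopy[OF m])
    also have "\<dots> = e (e m) \<oplus>\<^bsub>C\<^esub> e (d (h m))" using eD(1,2) dD(1) hD(1) m by simp
    also have "\<dots> = e (e m)" using ed[OF hD(1)[OF m]] eD(1) m by simp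
    finally show ?thesis by simp
  qed
  have "e (b i) = e v"
  proof -
    have "e (b i) = e (e v) \<oplus>\<^bsub>C\<^esub> e (d z)" unfolding split_b using eD(2) evc dzc by simp
    also have "\<dots> = e v" using idem[OF vc] ed[OF zc] evc by simp
    finally show ?thesis .
  qed
  then show thesis using that[OF zD] split_b by simp
qed

theorem proposition3p3:
  fixes R :: "('r, 'p) ring_scheme"
    and G :: "('g, 'q) monoid_scheme"
    and \<phi> :: "'g \<Rightarrow> real"
    and A :: "('g \<Rightarrow> 'r) ring"
    and D :: "('g \<Rightarrow> 'r) set"
    and Csucc :: "('g \<Rightarrow> 'r, 'k, 'x) right_module_scheme" and Isucc :: "'ik set" and bsucc :: "'ik \<Rightarrow> 'k"
    and Cn :: "('g \<Rightarrow> 'r, 'm, 'y) right_module_scheme" and In :: "'im set" and bn :: "'im \<Rightarrow> 'm"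
    and Cpred :: "('g \<Rightarrow> 'r, 'n, 'z) right_module_scheme" and Ipred :: "'in set" and bpred :: "'in \<Rightarrow> 'n"
    and dsucc :: "'k \<Rightarrow> 'm" and dn :: "'m \<Rightarrow> 'n"
    and Hpred :: "'n \<Rightarrow> 'm" and Hn :: "'m \<Rightarrow> 'k"
  assumes "ring R"
    and "finitely_generated_group G"
    and "\<phi> \<in> characters G"
    and A: "A = novikov_ring R G \<phi>"
    and D: "D = division_closure A (group_ring R G)"
    and "based_free A Csucc Isucc bsucc"
    and "based_free A Cn In bn"
    and "based_free A Cpred Ipred bpred"
    and "finitely_generated_module A Cn"
    and "finitely_generated_module A Cpred"
    and "dsucc \<in> right_module_hom A Csucc Cn"
    and "dn \<in> right_module_hom A Cn Cpred"
    and chain_complex: "\<And>x. x \<in> carrier Csucc \<Longrightarrow> dn (dsucc x) = \<zero>\<^bsub>Cpred\<^esub>"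
    and "defined_over A D Isucc bsucc Cn In bn dsucc"
    and "defined_over A D In bn Cpred Ipred bpred dn"
    and "Hpred \<in> right_module_hom A Cpred Cn"
    and "defined_over A D Ipred bpred Cn In bn Hpred"
    and "Hn \<in> right_module_hom A Cn Csucc"
    and homotopy: "\<And>x. x \<in> carrier Cn \<Longrightarrow> Hpred (dn x) \<oplus>\<^bsub>Cn\<^esub> dsucc (Hn x) = x"
  shows "\<exists>Hn'. Hn' \<in> right_module_hom A Cn Csucc \<and>
               defined_over A D In bn Csucc Isucc bsucc Hn' \<and>
               (\<forall>x\<in>carrier Cn. Hpred (dn x) \<oplus>\<^bsub>Cn\<^esub> dsucc (Hn' x) = x)"
proof -
  have "group G" using assms(2) by (simp add: finitely_generated_group_def)
  moreover have "\<phi> \<in> hom G real_add_group" using assms(3) by (simp add: characters_def)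
  ultimately interpret Nv: novikov R G \<phi>
    using assms(1) by (intro novikov.intro novikov_axioms.intro)
  interpret A: ring A unfolding A by (rule Nv.ring_novikov)
  have D_closed: "division_closed A D" "group_ring R G \<subseteq> D"
    unfolding D using division_closed_closure[OF A.ring_axioms] subringE(1)[OF Nv.subring_group_ring]
    by (simp_all add: A)
  then have sD: "subring D A" by (simp add: division_closed_def)
  have modules: "based_free_module A Csucc Isucc bsucc" "based_free_module A Cn In bn"
      "based_free_module A Cpred Ipred bpred"
    using assms(6-8)
    by (simp_all add: based_free_module_def based_free_module_axioms_def based_free_def)
  interpret S: based_free_module A Csucc Isucc bsucc by (rule modules)
  interpret C: based_free_module A Cn In bn by (rule modules)
  interpret P: based_free_module A Cpred Ipred bpred by (rule modules)
  note hom = assms(11,12,16,18)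
  show ?thesis
  proof (cases "\<one>\<^bsub>A\<^esub> = \<zero>\<^bsub>A\<^esub>")
    \<comment> \<open>Over the zero ring the basis may be infinite, but then every homomorphism is defined over \<open>D\<close>.\<close>
    case True
    have "matrix_entry A bn Csucc Isucc bsucc Hn j i \<in> D" if "j \<in> Isucc" "i \<in> In" for i j
    proof -
      have "matrix_entry A bn Csucc Isucc bsucc Hn j i \<in> carrier A"
        using that right_module_homD(1)[OF hom(4)] C.basis_closed by (simp add: matrix_entry_def)
      then show ?thesis using A.one_zeroD[OF True] subringE(2)[OF sD] by simp
    qed
    then show ?thesis using hom(4) homotopy by (auto simp: defined_over_def)
  next
    case False
    have In: "finite In" using C.finite_basis[OF assms(9) False] .
    define e where "e x = Hpred (dn x)" for x
    have e: "e \<in> right_module_hom A Cn Cn"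
      unfolding e_def by (rule right_module_hom_comp[OF hom(2,3)])
    have e_over: "defined_over A D In bn Cn In bn e"
    proof -
      have "e (bn i) \<in> C.basis_span D" if "i \<in> In" for i
        unfolding e_def
        by (intro defined_over_hom_basis_span[OF modules(3,2) sD hom(3) assms(17)]
            defined_over_hom_basis_span[OF modules(2,3) sD hom(2) assms(15)] C.basis_in_basis_span[OF sD that])
      then show ?thesis by (simp add: defined_over_def matrix_entry_def C.basis_span_def)
    qed
    have e_dsucc: "e (dsucc x) = \<zero>\<^bsub>Cn\<^esub>" if "x \<in> carrier Csucc" for x
    proof -
      have "Hpred \<zero>\<^bsub>Cpred\<^esub> = \<zero>\<^bsub>Cn\<^esub>"
        using right_module_hom_finsum[OF P.right_module_axioms C.right_module_axioms hom(3), of "{}"]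
        by simp
      then show ?thesis using chain_complex[OF that] by (simp add: e_def)
    qed
    have "\<exists>y. y \<in> S.basis_span D \<and> e (bn i) \<oplus>\<^bsub>Cn\<^esub> dsucc y = bn i" if i: "i \<in> In" for i
      using Nv.ex_homotopy_value_in_basis_span[OF modules(2,1)[unfolded A] In D_closed[unfolded A]
          hom(1)[unfolded A] assms(14)[unfolded A] hom(4)[unfolded A] e[unfolded A] e_over[unfolded A]
          e_dsucc _ i] homotopy unfolding A e_def by metis
    then obtain y where y: "\<And>i. i \<in> In \<Longrightarrow> y i \<in> S.basis_span D"
      "\<And>i. i \<in> In \<Longrightarrow> e (bn i) \<oplus>\<^bsub>Cn\<^esub> dsucc (y i) = bn i" by metis
    obtain Hn' where Hn': "Hn' \<in> right_module_hom A Cn Csucc" "\<And>i. i \<in> In \<Longrightarrow> Hn' (bn i) = y i"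
      using C.ex_linear_extension[OF S.right_module_axioms In, of y] S.basis_span_closed[OF y(1)] by blast
    have "defined_over A D In bn Csucc Isucc bsucc Hn'"
      using y(1) Hn'(2) by (simp add: defined_over_def matrix_entry_def S.basis_span_def)
    moreover have "e x \<oplus>\<^bsub>Cn\<^esub> dsucc (Hn' x) = x" if x: "x \<in> carrier Cn" for x
    proof (rule C.hom_eqI[OF C.right_module_axioms _ _ _ x, where g = "\<lambda>x. x"])
      show "(\<lambda>x. e x \<oplus>\<^bsub>Cn\<^esub> dsucc (Hn' x)) \<in> right_module_hom A Cn Cn"
        by (intro right_module_hom_add[OF C.right_module_axioms e] right_module_hom_comp[OF Hn'(1) hom(1)])
      show "(\<lambda>x. x) \<in> right_module_hom A Cn Cn" by (simp add: right_module_hom_def)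
    qed (simp add: Hn'(2) y(2))
    ultimately show ?thesis using Hn'(1) by (auto simp: e_def)
  qed
qed

end
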